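(* Fix $1\le m\le\infty$ and let $\mathbf J^{(m)}=[J^{(m)}_{n,k}(\boldsymbol\beta)]_{n,k\ge0}$ be the $m$-Jacobi--Rogers triangle with production matrix $P^{(m)}(\boldsymbol\beta)$. Let $a,b,u,v,\lambda,\widehat a_i,\widehat b_i,\widehat c_i$ ($i\ge1$) be indeterminates and $\mathbf x$ a set of indeterminates. Assume that $P^{(m)}(\boldsymbol\beta)$ equals a finite product, in some order, of $\mathbf J(a,b,u,v,\lambda)$ and matrices each of the form $\mathbf L(\widehat a_i,\widehat b_i,\widehat c_i)$ or $\boldsymbol\Gamma^{(\Lambda,f_i(t))}$ ($i\ge1$), where each $f_i(t)$ is an $\mathbf x$-Pólya frequency function. Then: (i) the row-generating polynomial sequence $(\mathbf J_n(q))_{n\ge0}$, $\mathbf J_n(q)=\sum_kJ^{(m)}_{n,k}(\boldsymbol\beta)q^k$, is $3$-$(a,b,u,v,\lambda,\widehat{\mathbf a},\widehat{\mathbf b},\widehat{\mathbf c},\mathbf x,q)$-log-convex; (ii) for all nonnegative real values of $a,b,u,v,\lambda,\widehat{\mathbf a},\widehat{\mathbf b},\widehat{\mathbf c},\mathbf x$, the convolution $z_n=\sum_{k=0}^nJ^{(m)}_{n,k}(\boldsymbol\beta)s_kt_{n-k}$ preserves the Stieltjes moment property (if $(s_n)$ and $(t_n)$ are Stieltjes moment sequences, so is $(z_n)$).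
   Context: Partial $m$-Łukasiewicz paths: paths in $\mathbb Z\times\mathbb N$ starting on the horizontal axis with steps $(1,s)$, $-m\le s\le1$. $J^{(m)}_{n,k}(\boldsymbol\beta)$ is the generating polynomial of such paths from $(0,0)$ to $(n,k)$, where a rise at height $i$ has weight $\beta^{(-1)}_i$ if $m=1$ and $1$ if $m>1$, a level step at height $i$ has weight $\beta^{(0)}_i$, and an $\ell$-fall from height $i$ has weight $\beta^{(\ell)}_i$. $P^{(m)}(\boldsymbol\beta)$ has $(i,i+1)$ entry $\beta^{(-1)}_i$ ($m=1$) or $1$ ($m>1$), $(i,j)$ entry $\beta^{(i-j)}_i$ for $i-m\le j\le i$, zero otherwise. $\mathbf L(a,b,c)$: lower bidiagonal, diagonal $ka+b$, subdiagonal $(k,k-1)$ entry $kc$. $\mathbf J(a,b,u,v,\lambda)$: tridiagonal with $(n,n+1)$ entry $un+u+v$, $(n,n)$ entry $(2\lambda u+a)n+b+\lambda(u+v)$, $(n,n-1)$ entry $\lambda(a+\lambda u)n$. $\boldsymbol\Gamma^{(\Lambda,f)}=[\frac{i!}{j!}f_{i-j}]_{i,j}$ for $f=\sum f_nt^n$. $f$ is an $\mathbf x$-Pólya frequency function if its Toeplitz matrix $[f_{i-j}]$ has all minors polynomials in $\mathbf x$ with nonnegative coefficients. For polynomials $(a_n)$ in indeterminates $\mathbf z$: $\mathcal L[a_i]=a_{i-1}a_{i+1}-a_i^2$, $\mathcal L^k=\mathcal L(\mathcal L^{k-1})$; $3$-$\mathbf z$-log-convex means $\mathcal L^k[a_i]$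 has nonnegative coefficients for $k\le3$. A real sequence is Stieltjes moment if $a_n=\int_0^\infty x^nd\mu(x)$ for a nonnegative measure $\mu$. *)

theory Defs
  imports
    "HOL-Analysis.Analysis"
    "HOL-Library.Poly_Mapping"
    "HOL-Library.Extended_Nat"
    "HOL-Computational_Algebra.Polynomial"
    "HOL-Computational_Algebra.Formal_Power_Series"
    "Jordan_Normal_Form.Determinant"
begin

section \<open>Multivariate polynomials with real coefficients\<close>

text \<open>
  A monomial is a finitely supported exponent vector; the ring structure on polynomials is
  the convolution product of the library.
\<close>

type_synonym 'v mpoly = "('v \<Rightarrow>\<^sub>0 nat) \<Rightarrow>\<^sub>0 real"

definition mvar :: "'v \<Rightarrow> 'v mpoly" where
  "mvar v = Poly_Mapping.single (Poly_Mapping.single v 1) 1"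

definition mconst :: "real \<Rightarrow> 'v mpoly" where
  "mconst c = Poly_Mapping.single 0 c"

definition mcoeff_nonneg :: "'v mpoly \<Rightarrow> bool" where
  "mcoeff_nonneg p \<longleftrightarrow> (\<forall>e. 0 \<le> Poly_Mapping.lookup p e)"

definition mpoly_in :: "'v set \<Rightarrow> 'v mpoly \<Rightarrow> bool" where
  "mpoly_in S p \<longleftrightarrow> (\<forall>e \<in> Poly_Mapping.keys p. Poly_Mapping.keys e \<subseteq> S)"

definition meval :: "('v \<Rightarrow> real) \<Rightarrow> 'v mpoly \<Rightarrow> real" where
  "meval \<rho> p = (\<Sum>e \<in> Poly_Mapping.keys p.
     Poly_Mapping.lookup p e * (\<Prod>v \<in> Poly_Mapping.keys e. \<rho> v ^ Poly_Mapping.lookup e v))"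

text \<open>
  The indeterminates \<open>a, b, u, v, \<lambda>\<close> and \<open>a_i, b_i, c_i\<close> (with hats).  The polynomial ring
  in these and in the set \<open>\<^bold>x\<close> of further indeterminates is \<open>(param + 'x) mpoly\<close>.
\<close>

datatype param = Pa | Pb | Pu | Pv | Plam | Pahat nat | Pbhat nat | Pchat nat

definition xvars :: "(param + 'x) set" where
  "xvars = range Inr"

text \<open>
  Each parameter is either kept as an indeterminate or set to a nonnegative real number.
  Setting parameters to numbers is what makes an identity between \<open>Pmat m \<beta>\<close> and a product of
  the matrices below possible when \<open>m > 1\<close>, since then \<open>Pmat m \<beta>\<close> has superdiagonal \<open>1\<close>.
\<close>

definition parameter_values :: "(param \<Rightarrow> (param + 'x) mpoly) \<Rightarrow> bool" where
  "parameter_values \<theta> \<longleftrightarrow> (\<forall>p. \<theta> p = mvar (Inl p) \<or> (\<exists>c\<ge>0. \<theta> p = mconst c))"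

section \<open>Partial \<open>m\<close>-Lukasiewicz paths\<close>

text \<open>
  A path from \<open>(0, 0)\<close> to \<open>(n, k)\<close> is given by the list of the heights of its \<open>n + 1\<close> vertices.
  The second condition on a step says that it goes down by at most \<open>m\<close>.
\<close>

definition luk_paths :: "enat \<Rightarrow> nat \<Rightarrow> nat \<Rightarrow> nat list set" where
  "luk_paths m n k = {h. length h = Suc n \<and> h ! 0 = 0 \<and> h ! n = k \<and>
     (\<forall>i<n. h ! Suc i \<le> h ! i + 1 \<and> enat (h ! i) \<le> enat (h ! Suc i) + m)}"

text \<open>\<open>\<beta> l i\<close> stands for \<open>\<beta>\<close> with upper index \<open>l\<close> (\<open>-1 \<le> l \<le> m\<close>) and lower index \<open>i\<close>.\<close>

definition rise_weight :: "enat \<Rightarrow> (int \<Rightarrow> nat \<Rightarrow> 'a::comm_ring_1) \<Rightarrow> nat \<Rightarrow> 'a" where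
  "rise_weight m \<beta> i = (if m = 1 then \<beta> (-1) i else 1)"

definition step_weight :: "enat \<Rightarrow> (int \<Rightarrow> nat \<Rightarrow> 'a::comm_ring_1) \<Rightarrow> nat \<Rightarrow> nat \<Rightarrow> 'a" where
  "step_weight m \<beta> i j = (if j = i + 1 then rise_weight m \<beta> i else \<beta> (int i - int j) i)"

definition jacobi_rogers :: "enat \<Rightarrow> (int \<Rightarrow> nat \<Rightarrow> 'a::comm_ring_1) \<Rightarrow> nat \<Rightarrow> nat \<Rightarrow> 'a" where
  "jacobi_rogers m \<beta> n k =
     (\<Sum>h \<in> luk_paths m n k. \<Prod>i<n. step_weight m \<beta> (h ! i) (h ! Suc i))"

definition jacobi_rogers_row ::
    "enat \<Rightarrow> (int \<Rightarrow> nat \<Rightarrow> 'a::comm_ring_1) \<Rightarrow> nat \<Rightarrow> 'a poly" where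
  "jacobi_rogers_row m \<beta> n = (\<Sum>k\<le>n. Polynomial.monom (jacobi_rogers m \<beta> n k) k)"

section \<open>Infinite matrices\<close>

type_synonym 'a imat = "nat \<Rightarrow> nat \<Rightarrow> 'a"

text \<open>All matrices below have at most one superdiagonal, so the sum is finite.\<close>

definition imat_mult :: "'a::comm_ring_1 imat \<Rightarrow> 'a imat \<Rightarrow> 'a imat" where
  "imat_mult A B = (\<lambda>i j. \<Sum>k | A i k \<noteq> 0. A i k * B k j)"

definition imat_one :: "'a::comm_ring_1 imat" where
  "imat_one = (\<lambda>i j. if i = j then 1 else 0)"

definition imat_prod :: "'a::comm_ring_1 imat list \<Rightarrow> 'a imat" where
  "imat_prod Ms = foldr imat_mult Ms imat_one"

definition Pmat :: "enat \<Rightarrow> (int \<Rightarrow> nat \<Rightarrow> 'a::comm_ring_1) \<Rightarrow> 'a imat" where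
  "Pmat m \<beta> = (\<lambda>i j.
     if j = i + 1 then rise_weight m \<beta> i
     else if j \<le> i \<and> enat i \<le> enat j + m then \<beta> (int i - int j) i
     else 0)"

definition Lmat :: "'a::comm_ring_1 \<Rightarrow> 'a \<Rightarrow> 'a \<Rightarrow> 'a imat" where
  "Lmat a b c = (\<lambda>k j.
     if j = k then of_nat k * a + b
     else if k = j + 1 then of_nat k * c
     else 0)"

definition Jmat :: "'a::comm_ring_1 \<Rightarrow> 'a \<Rightarrow> 'a \<Rightarrow> 'a \<Rightarrow> 'a \<Rightarrow> 'a imat" where
  "Jmat a b u v lam = (\<lambda>n j.
     if j = n + 1 then u * of_nat n + u + v
     else if j = n then (2 * lam * u + a) * of_nat n + b + lam * (u + v)
     else if n = j + 1 then lam * (a + lam * u) * of_nat n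
     else 0)"

definition Gmat :: "'v mpoly fps \<Rightarrow> 'v mpoly imat" where
  "Gmat f = (\<lambda>i j. if j \<le> i then mconst (fact i / fact j) * fps_nth f (i - j) else 0)"

section \<open>Polya frequency functions\<close>

definition toeplitz :: "'a::zero fps \<Rightarrow> 'a imat" where
  "toeplitz f = (\<lambda>i j. if j \<le> i then fps_nth f (i - j) else 0)"

definition imat_minor ::
    "'a::comm_ring_1 imat \<Rightarrow> nat \<Rightarrow> (nat \<Rightarrow> nat) \<Rightarrow> (nat \<Rightarrow> nat) \<Rightarrow> 'a" where
  "imat_minor A k r c = Determinant.det (Matrix.mat k k (\<lambda>(i, j). A (r i) (c j)))"

definition polya_frequency :: "'v set \<Rightarrow> 'v mpoly fps \<Rightarrow> bool" where
  "polya_frequency S f \<longleftrightarrow>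
     (\<forall>k r c. strict_mono_on {..<k} r \<longrightarrow> strict_mono_on {..<k} c \<longrightarrow>
        mpoly_in S (imat_minor (toeplitz f) k r c) \<and>
        mcoeff_nonneg (imat_minor (toeplitz f) k r c))"

section \<open>Log-convexity and Stieltjes moment sequences\<close>

definition Lop :: "(nat \<Rightarrow> 'a::comm_ring_1) \<Rightarrow> nat \<Rightarrow> 'a" where
  "Lop a i = a (i - 1) * a (i + 1) - (a i)\<^sup>2"

text \<open>
  The sequence lives in the polynomial ring in \<open>'v\<close> and one more indeterminate \<open>q\<close>, the
  variable of the outer type \<^typ>\<open>'a poly\<close>.  The \<open>k\<close>-fold iterate of \<^const>\<open>Lop\<close> is meaningful
  only at indices \<open>i \<ge> k\<close>, where it involves no entry of negative index.
\<close>

definition log_convex_order :: "nat \<Rightarrow> (nat \<Rightarrow> 'v mpoly poly) \<Rightarrow> bool" where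
  "log_convex_order r a \<longleftrightarrow>
     (\<forall>k\<le>r. \<forall>i\<ge>k. \<forall>d. mcoeff_nonneg (Polynomial.coeff ((Lop ^^ k) a i) d))"

definition stieltjes_moment :: "(nat \<Rightarrow> real) \<Rightarrow> bool" where
  "stieltjes_moment s \<longleftrightarrow>
     (\<exists>\<mu> :: real measure. sets \<mu> = sets borel \<and>
        (\<forall>n. set_integrable \<mu> {0..} (\<lambda>x. x ^ n) \<and>
             s n = set_lebesgue_integral \<mu> {0..} (\<lambda>x. x ^ n)))"

end

theory Submission
  imports Defs
    "HOL-Probability.Helly_Selection"
    "Jordan_Normal_Form.Char_Poly"
begin

text \<open>
  Read row \<open>i\<close> of a matrix as the image of \<open>x^i\<close> under a linear map of polynomials.  The matrix \<open>B\<close> of the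
  \<open>binom(n, k) q^(n-k)\<close> is the substitution of \<open>x + q\<close> for \<open>x\<close>, and \<open>L(a,b,c)\<close> is \<open>(a x + c) d/dx + b\<close>, so
  that conjugation by \<open>B\<close> turns \<open>L(a,b,c)\<close> into \<open>L(a,b,c+qa)\<close>; similarly it turns \<open>J(a,b,u,v,\<lambda>)\<close> into
  \<open>J(a,b,u,v,\<lambda>+q)\<close>.  It fixes the matrices \<open>\<Gamma>\<close>, because \<open>f \<mapsto> \<Gamma>(f)\<close> is multiplicative and
  \<open>B = \<Gamma>(e^(qt))\<close>.  All these matrices are coefficientwise totally positive, hence so is
  \<open>Q = B^(-1) P B\<close> by Cauchy--Binet.  The row polynomials are the \<open>(Q^n)_00\<close>, and their Hankel matrix is
  the product of the matrices of the \<open>(Q^n)_0k\<close> and of the \<open>(Q^n)_k0\<close>, which are built from \<open>Q\<close> row by row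
  and column by column; so it is totally positive as well.

  The first three iterates of \<open>Lop\<close> are polynomials with nonnegative coefficients in Hankel minors of
  order at most \<open>4\<close>.  For the convolution, total positivity and Stieltjes' theorem make \<open>J_n(x)\<close>, and
  then \<open>y^n J_n(x/y)\<close>, a Stieltjes moment sequence for all \<open>x, y \<ge> 0\<close>.  Integrating the Hankel forms
  of the latter over \<open>x\<close> and then over \<open>y\<close> against the representing measures of \<open>s\<close> and \<open>t\<close> shows that
  the Hankel forms of \<open>z\<close> are positive semidefinite.
\<close>

section \<open>Minors and the Cauchy--Binet formula\<close>

lemma permutes_lessThan_less: "p permutes {..<k} \<Longrightarrow> i < k \<Longrightarrow> p i < (k::nat)"
  using permutes_in_image[of p "{..<k}" i] by simp

lemma imat_minor_leibniz:
  "imat_minor A k r c = (\<Sum>p | p permutes {..<k}. signof p * (\<Prod>i<k. A (r i) (c (p i))))"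
proof -
  have "(\<Prod>i<k. Matrix.mat k k (\<lambda>(i, j). A (r i) (c j)) $$ (i, p i)) = (\<Prod>i<k. A (r i) (c (p i)))"
    if "p permutes {..<k}" for p
    using that by (intro prod.cong) (auto simp: permutes_lessThan_less)
  then show ?thesis
    unfolding imat_minor_def
    by (subst det_def'[of _ k]) (auto simp: atLeast0LessThan intro!: sum.cong)
qed

lemma imat_minor_cong:
  assumes "\<And>i j. i < k \<Longrightarrow> j < k \<Longrightarrow> A (r i) (c j) = A' (r' i) (c' j)"
  shows "imat_minor A k r c = imat_minor A' k r' c'"
  unfolding imat_minor_def using assms by (intro arg_cong[where f = Determinant.det] cong_mat) auto

lemma imat_minor_transpose:
  "imat_minor (\<lambda>i j. A j i) k r c = imat_minor A k c r"
  unfolding imat_minor_def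
  by (subst det_transpose[of _ k, symmetric])
     (auto intro!: arg_cong[where f = Determinant.det] eq_matI)

lemma (in comm_ring_hom) imat_minor_hom:
  "imat_minor (\<lambda>i j. hom (A i j)) k r c = hom (imat_minor A k r c)"
  unfolding imat_minor_def hom_det[symmetric]
  by (intro arg_cong[where f = Determinant.det] eq_matI) auto

lemma imat_minor_0 [simp]: "imat_minor A 0 r c = 1"
  by (simp add: imat_minor_leibniz)

lemma imat_minor_expand_row:
  "imat_minor A (Suc k) r c =
     (\<Sum>j<Suc k. (-1) ^ j * A (r 0) (c j) *
        imat_minor A k (\<lambda>i. r (Suc i)) (\<lambda>i. c (if i < j then i else Suc i)))"
proof -
  let ?M = "Matrix.mat (Suc k) (Suc k) (\<lambda>(i, j). A (r i) (c j))"
  have "?M $$ (0, j) * cofactor ?M 0 j = (-1) ^ j * A (r 0) (c j) *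
      imat_minor A k (\<lambda>i. r (Suc i)) (\<lambda>i. c (if i < j then i else Suc i))" if "j < Suc k" for j
  proof -
    have "mat_delete ?M 0 j =
        Matrix.mat k k (\<lambda>(i, i'). A (r (Suc i)) (c (if i' < j then i' else Suc i')))"
      by (rule eq_matI) (auto simp: mat_delete_def)
    then show ?thesis
      using that by (simp add: cofactor_def imat_minor_def mult_ac)
  qed
  then show ?thesis
    unfolding imat_minor_def[of A "Suc k"] by (subst laplace_expansion_row[of _ "Suc k" 0]) auto
qed

lemma imat_minor_expand_row_single:
  assumes "\<And>j. 0 < j \<Longrightarrow> j \<le> k \<Longrightarrow> A (r 0) (c j) = 0"
  shows "imat_minor A (Suc k) r c =
    A (r 0) (c 0) * imat_minor A k (\<lambda>i. r (Suc i)) (\<lambda>j. c (Suc j))"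
  unfolding imat_minor_expand_row lessThan_Suc_eq_insert_0
  using assms by (subst sum.insert) (auto intro!: sum.neutral)

lemma imat_minor_scale:
  "imat_minor (\<lambda>i j. x i * A i j * y j) k r c =
     (\<Prod>i<k. x (r i)) * (\<Prod>j<k. y (c j)) * imat_minor A k r c"
proof -
  have "(\<Prod>i<k. x (r i) * A (r i) (c (p i)) * y (c (p i))) =
      (\<Prod>i<k. x (r i)) * (\<Prod>j<k. y (c j)) * (\<Prod>i<k. A (r i) (c (p i)))"
    if "p permutes {..<k}" for p
    using prod.permute[OF that, of "\<lambda>j. y (c j)"] by (simp add: prod.distrib comp_def)
  then show ?thesis
    unfolding imat_minor_leibniz sum_distrib_left
    by (intro sum.cong refl) (simp add: mult_ac)
qed

lemma imat_minor_permute_rows: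
  assumes "p permutes {..<k}"
  shows "imat_minor A k (\<lambda>i. r (p i)) c = signof p * imat_minor A k r c"
proof -
  have "imat_minor A k (\<lambda>i. r (p i)) c =
    Determinant.det (Matrix.mat k k (\<lambda>(i, j). Matrix.mat k k (\<lambda>(i, j). A (r i) (c j)) $$ (p i, j)))"
    unfolding imat_minor_def using assms
    by (intro arg_cong[where f = Determinant.det] cong_mat) (auto simp: permutes_lessThan_less)
  also have "\<dots> = signof p * imat_minor A k r c"
    unfolding imat_minor_def
    by (rule det_permute_rows) (use assms in \<open>auto simp: atLeast0LessThan\<close>)
  finally show ?thesis .
qed

lemma imat_minor_repeated_row:
  assumes "\<not> inj_on r {..<k}"
  shows "imat_minor A k r c = 0"
proof -
  obtain i j where "i \<noteq> j" "i < k" "j < k" "r i = r j"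
    using assms unfolding inj_on_def by auto
  then show ?thesis
    unfolding imat_minor_def by (intro det_identical_rows[of _ k i j]) (auto intro!: eq_vecI)
qed

lemma imat_minor_mult_sum_maps:
  assumes "\<And>i j. i < k \<Longrightarrow> j < k \<Longrightarrow> C (r i) (c j) = (\<Sum>l<n. A (r i) l * B l (c j))"
  shows "imat_minor C k r c =
    (\<Sum>g \<in> {..<k} \<rightarrow>\<^sub>E {..<n}. (\<Prod>i<k. A (r i) (g i)) * imat_minor B k g c)"
proof -
  have "(\<Prod>i<k. C (r i) (c (p i))) =
      (\<Sum>g \<in> {..<k} \<rightarrow>\<^sub>E {..<n}. (\<Prod>i<k. A (r i) (g i)) * (\<Prod>i<k. B (g i) (c (p i))))"
    if "p permutes {..<k}" for p
  proof -
    have "(\<Prod>i<k. C (r i) (c (p i))) = (\<Prod>i<k. \<Sum>l<n. A (r i) l * B l (c (p i)))"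
      using that by (intro prod.cong) (auto simp: assms permutes_lessThan_less)
    then show ?thesis by (simp add: prod_sum_PiE prod.distrib)
  qed
  then have "imat_minor C k r c = (\<Sum>p | p permutes {..<k}. \<Sum>g \<in> {..<k} \<rightarrow>\<^sub>E {..<n}.
      signof p * ((\<Prod>i<k. A (r i) (g i)) * (\<Prod>i<k. B (g i) (c (p i)))))"
    unfolding imat_minor_leibniz by (simp add: sum_distrib_left)
  also have "\<dots> = (\<Sum>g \<in> {..<k} \<rightarrow>\<^sub>E {..<n}. \<Sum>p | p permutes {..<k}.
      signof p * ((\<Prod>i<k. A (r i) (g i)) * (\<Prod>i<k. B (g i) (c (p i)))))"
    by (rule sum.swap)
  finally show ?thesis
    by (simp add: imat_minor_leibniz sum_distrib_left mult_ac)
qed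

lemma bij_betw_restrict_comp_permutes:
  assumes e: "bij_betw e A S" and "finite A"
  shows "bij_betw (\<lambda>p. restrict (e \<circ> p) A) {p. p permutes A} {g \<in> extensional A. bij_betw g A S}"
proof (rule bij_betw_byWitness[where f' = "\<lambda>g i. if i \<in> A then inv_into A e (g i) else i"])
  have e_inv: "inv_into A e (e i) = i" if "i \<in> A" for i
    using that e by (simp add: bij_betw_inv_into_left)
  show "\<forall>p\<in>{p. p permutes A}. (\<lambda>i. if i \<in> A then inv_into A e (restrict (e \<circ> p) A i) else i) = p"
    by (auto simp: fun_eq_iff e_inv permutes_in_image permutes_not_in)
  show "\<forall>g\<in>{g \<in> extensional A. bij_betw g A S}.
      restrict (e \<circ> (\<lambda>i. if i \<in> A then inv_into A e (g i) else i)) A = g"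
    using e by (auto simp: fun_eq_iff extensional_def bij_betw_inv_into_right bij_betw_apply)
  show "(\<lambda>p. restrict (e \<circ> p) A) ` {p. p permutes A} \<subseteq> {g \<in> extensional A. bij_betw g A S}"
    using e by (auto intro!: bij_betw_trans permutes_imp_bij)
  show "(\<lambda>g i. if i \<in> A then inv_into A e (g i) else i) ` {g \<in> extensional A. bij_betw g A S}
      \<subseteq> {p. p permutes A}"
  proof safe
    fix g assume "bij_betw g A S"
    then have "bij_betw (inv_into A e \<circ> g) A A"
      using bij_betw_inv_into[OF e] by (rule bij_betw_trans)
    then have "bij_betw (\<lambda>i. if i \<in> A then inv_into A e (g i) else i) A A"
      by (simp cong: bij_betw_cong)
    then show "(\<lambda>i. if i \<in> A then inv_into A e (g i) else i) permutes A"
      by (rule bij_imp_permutes) simp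
  qed
qed

lemma imat_minor_mult_sum_bijections:
  assumes e: "bij_betw e {..<k} S"
  shows "(\<Sum>g | g \<in> extensional {..<k} \<and> bij_betw g {..<k} S.
      (\<Prod>i<k. A (r i) (g i)) * imat_minor B k g c) = imat_minor A k r e * imat_minor B k e c"
proof -
  have "(\<Sum>g | g \<in> extensional {..<k} \<and> bij_betw g {..<k} S.
        (\<Prod>i<k. A (r i) (g i)) * imat_minor B k g c) =
      (\<Sum>p | p permutes {..<k}. (\<Prod>i<k. A (r i) (restrict (e \<circ> p) {..<k} i)) *
        imat_minor B k (restrict (e \<circ> p) {..<k}) c)"
    by (rule sum.reindex_bij_betw[OF bij_betw_restrict_comp_permutes[OF e], symmetric]) simp
  also have "\<dots> = (\<Sum>p | p permutes {..<k}.
      signof p * (\<Prod>i<k. A (r i) (e (p i))) * imat_minor B k e c)"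
  proof (rule sum.cong[OF refl])
    fix p assume "p \<in> {p. p permutes {..<k}}"
    moreover have "imat_minor B k (restrict (e \<circ> p) {..<k}) c = imat_minor B k (\<lambda>i. e (p i)) c"
      by (rule imat_minor_cong) simp
    ultimately show "(\<Prod>i<k. A (r i) (restrict (e \<circ> p) {..<k} i)) *
          imat_minor B k (restrict (e \<circ> p) {..<k}) c =
        signof p * (\<Prod>i<k. A (r i) (e (p i))) * imat_minor B k e c"
      by (simp add: imat_minor_permute_rows)
  qed
  also have "\<dots> = imat_minor A k r e * imat_minor B k e c"
    by (simp add: imat_minor_leibniz[of A] sum_distrib_right)
  finally show ?thesis .
qed

theorem imat_minor_cauchy_binet:
  assumes "\<And>i j. i < k \<Longrightarrow> j < k \<Longrightarrow> C (r i) (c j) = (\<Sum>l<n. A (r i) l * B l (c j))"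
  shows "imat_minor C k r c = (\<Sum>S | S \<subseteq> {..<n} \<and> card S = k.
    imat_minor A k r (enumerate S) * imat_minor B k (enumerate S) c)"
proof -
  let ?P = "{..<k} \<rightarrow>\<^sub>E {..<n}" and ?\<S> = "{S. S \<subseteq> {..<n} \<and> card S = k}"
  let ?T = "\<lambda>g. (\<Prod>i<k. A (r i) (g i)) * imat_minor B k g c"
  have "finite ?P" by (simp add: finite_PiE)
  then have fin_inj: "finite {g \<in> ?P. inj_on g {..<k}}" by (rule rev_finite_subset) auto
  have "imat_minor C k r c = sum ?T ?P" by (rule imat_minor_mult_sum_maps) (rule assms)
  also have "\<dots> = sum ?T {g \<in> ?P. inj_on g {..<k}}"
    using \<open>finite ?P\<close> by (intro sum.mono_neutral_right) (auto simp: imat_minor_repeated_row)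
  also have "\<dots> = (\<Sum>S\<in>?\<S>. sum ?T {g \<in> {g \<in> ?P. inj_on g {..<k}}. g ` {..<k} = S})"
    using fin_inj by (intro sum.group[symmetric]) (auto simp: card_image PiE_iff image_subset_iff)
  also have "\<dots> = (\<Sum>S\<in>?\<S>. imat_minor A k r (enumerate S) * imat_minor B k (enumerate S) c)"
  proof (rule sum.cong[OF refl])
    fix S assume "S \<in> ?\<S>"
    then have S: "S \<subseteq> {..<n}" "card S = k" "finite S" by (auto intro: finite_subset)
    have "{g \<in> {g \<in> ?P. inj_on g {..<k}}. g ` {..<k} = S} =
        {g. g \<in> extensional {..<k} \<and> bij_betw g {..<k} S}"
      using S(1) by (auto simp: bij_betw_def PiE_iff)
    moreover have "bij_betw (enumerate S) {..<k} S"
      using finite_bij_enumerate[OF S(3)] S(2) by simp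
    ultimately show "sum ?T {g \<in> {g \<in> ?P. inj_on g {..<k}}. g ` {..<k} = S} =
        imat_minor A k r (enumerate S) * imat_minor B k (enumerate S) c"
      by (simp only: imat_minor_mult_sum_bijections)
  qed
  finally show ?thesis .
qed

section \<open>Infinite matrices with finite rows\<close>

definition row_finite :: "'a::comm_ring_1 imat \<Rightarrow> bool" where
  "row_finite A \<longleftrightarrow> (\<forall>i. finite {j. A i j \<noteq> 0})"

lemma row_finiteI:
  assumes "\<And>i j. b i < j \<Longrightarrow> A i j = 0"
  shows "row_finite A"
proof -
  have "{j. A i j \<noteq> 0} \<subseteq> {..b i}" for i
    using assms by (auto simp: not_less[symmetric])
  then show ?thesis unfolding row_finite_def by (auto intro: finite_subset)
qed

lemma imat_mult_eq_sum:
  assumes "finite S" "\<And>l. l \<notin> S \<Longrightarrow> A i l = 0"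
  shows "imat_mult A B i j = (\<Sum>l\<in>S. A i l * B l j)"
  unfolding imat_mult_def using assms by (intro sum.mono_neutral_left) auto

lemma imat_mult_eq_sum_col:
  assumes "row_finite A" "finite S" "\<And>l. l \<notin> S \<Longrightarrow> B l j = 0"
  shows "imat_mult A B i j = (\<Sum>l\<in>S. A i l * B l j)"
proof -
  have "imat_mult A B i j = (\<Sum>l\<in>{l. A i l \<noteq> 0} \<union> S. A i l * B l j)"
    using assms by (intro imat_mult_eq_sum) (auto simp: row_finite_def)
  also have "\<dots> = (\<Sum>l\<in>S. A i l * B l j)"
    using assms by (intro sum.mono_neutral_right) (auto simp: row_finite_def)
  finally show ?thesis .
qed

lemma row_finite_one: "row_finite imat_one"
  by (rule row_finiteI) (auto simp: imat_one_def)

lemma row_finite_scalar: "row_finite (\<lambda>i j. b * imat_one i j)"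
  by (rule row_finiteI) (auto simp: imat_one_def)

lemma row_finite_add: "row_finite A \<Longrightarrow> row_finite B \<Longrightarrow> row_finite (\<lambda>i j. A i j + B i j)"
  unfolding row_finite_def
  by (auto intro: finite_subset[of "{j. A i j + B i j \<noteq> 0}"
        "{j. A i j \<noteq> 0} \<union> {j. B i j \<noteq> 0}" for i])

lemma row_finite_mult:
  assumes "row_finite A" "row_finite B"
  shows "row_finite (imat_mult A B)"
  unfolding row_finite_def
proof
  fix i
  show "finite {j. imat_mult A B i j \<noteq> 0}"
  proof (rule finite_subset)
    show "{j. imat_mult A B i j \<noteq> 0} \<subseteq> (\<Union>l\<in>{l. A i l \<noteq> 0}. {j. B l j \<noteq> 0})"
    proof
      fix j assume "j \<in> {j. imat_mult A B i j \<noteq> 0}"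
      then obtain l where "l \<in> {l. A i l \<noteq> 0}" "A i l * B l j \<noteq> 0"
        unfolding imat_mult_def by (metis (mono_tags, lifting) mem_Collect_eq sum.neutral)
      then show "j \<in> (\<Union>l\<in>{l. A i l \<noteq> 0}. {j. B l j \<noteq> 0})" by force
    qed
  qed (use assms in \<open>auto simp: row_finite_def\<close>)
qed

lemma imat_mult_assoc:
  assumes A: "row_finite A" and B: "row_finite B"
  shows "imat_mult (imat_mult A B) C = imat_mult A (imat_mult B C)"
proof (intro ext)
  fix i j
  let ?S = "{m. A i m \<noteq> 0}"
  define T where "T = (\<Union>m\<in>?S. {l. B m l \<noteq> 0})"
  have S: "finite ?S" and T: "finite T"
    using A B by (auto simp: row_finite_def T_def)
  have AB: "imat_mult A X i l = (\<Sum>m\<in>?S. A i m * X m l)" for X l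
    using S by (intro imat_mult_eq_sum) auto
  have "imat_mult (imat_mult A B) C i j = (\<Sum>l\<in>T. imat_mult A B i l * C l j)"
    using T by (intro imat_mult_eq_sum) (auto simp: T_def AB intro!: sum.neutral)
  also have "\<dots> = (\<Sum>l\<in>T. \<Sum>m\<in>?S. A i m * (B m l * C l j))"
    by (simp add: AB sum_distrib_right mult.assoc)
  also have "\<dots> = (\<Sum>m\<in>?S. \<Sum>l\<in>T. A i m * (B m l * C l j))"
    by (rule sum.swap)
  also have "\<dots> = (\<Sum>m\<in>?S. A i m * imat_mult B C m j)"
  proof (rule sum.cong[OF refl])
    fix m assume "m \<in> ?S"
    then have "imat_mult B C m j = (\<Sum>l\<in>T. B m l * C l j)"
      using T by (intro imat_mult_eq_sum) (auto simp: T_def)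
    then show "(\<Sum>l\<in>T. A i m * (B m l * C l j)) = A i m * imat_mult B C m j"
      by (simp only: sum_distrib_left)
  qed
  also have "\<dots> = imat_mult A (imat_mult B C) i j"
    by (rule AB[symmetric])
  finally show "imat_mult (imat_mult A B) C i j = imat_mult A (imat_mult B C) i j" .
qed

lemma imat_mult_add_left:
  assumes "row_finite A" "row_finite A'"
  shows "imat_mult (\<lambda>i j. A i j + A' i j) B = (\<lambda>i j. imat_mult A B i j + imat_mult A' B i j)"
proof (intro ext)
  fix i j
  let ?S = "{l. A i l \<noteq> 0} \<union> {l. A' i l \<noteq> 0}"
  have "finite ?S" using assms by (auto simp: row_finite_def)
  then have "imat_mult X B i j = (\<Sum>l\<in>?S. X i l * B l j)" if "\<And>l. l \<notin> ?S \<Longrightarrow> X i l = 0" for X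
    using that by (rule imat_mult_eq_sum)
  from this[of A] this[of A'] this[of "\<lambda>i j. A i j + A' i j"]
  show "imat_mult (\<lambda>i j. A i j + A' i j) B i j = imat_mult A B i j + imat_mult A' B i j"
    by (simp add: distrib_right sum.distrib)
qed

lemma imat_mult_add_right:
  "imat_mult A (\<lambda>i j. B i j + B' i j) = (\<lambda>i j. imat_mult A B i j + imat_mult A B' i j)"
  by (simp add: imat_mult_def fun_eq_iff distrib_left sum.distrib)

lemma imat_scalar_mult: "imat_mult (\<lambda>i j. b * imat_one i j) A = (\<lambda>i j. b * A i j)"
  by (intro ext, subst imat_mult_eq_sum[where S = "{_}"]) (auto simp: imat_one_def)

lemma imat_mult_scalar:
  "row_finite A \<Longrightarrow> imat_mult A (\<lambda>i j. b * imat_one i j) = (\<lambda>i j. b * A i j)"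
  by (intro ext, subst imat_mult_eq_sum_col[where S = "{_}"]) (auto simp: imat_one_def)

lemma imat_one_mult: "imat_mult imat_one A = A"
  using imat_scalar_mult[of 1 A] by simp

lemma imat_mult_one: "row_finite A \<Longrightarrow> imat_mult A imat_one = A"
  using imat_mult_scalar[of A 1] by simp

primrec imat_pow :: "'a::comm_ring_1 imat \<Rightarrow> nat \<Rightarrow> 'a imat" where
  "imat_pow A 0 = imat_one"
| "imat_pow A (Suc n) = imat_mult (imat_pow A n) A"

lemma row_finite_pow: "row_finite A \<Longrightarrow> row_finite (imat_pow A n)"
  by (induction n) (auto intro: row_finite_one row_finite_mult)

lemma imat_pow_add:
  assumes "row_finite A"
  shows "imat_pow A (m + n) = imat_mult (imat_pow A m) (imat_pow A n)"
proof (induction n)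
  case 0
  show ?case using assms by (simp add: imat_mult_one row_finite_pow)
next
  case (Suc n)
  then show ?case using assms by (simp add: imat_mult_assoc row_finite_pow)
qed

lemma imat_pow_Suc_left: "row_finite A \<Longrightarrow> imat_pow A (Suc n) = imat_mult A (imat_pow A n)"
  using imat_pow_add[of A 1 n] by (simp add: imat_one_mult)

lemma imat_pow_intertwine:
  assumes "row_finite A" "row_finite B" "row_finite A'"
    and "imat_mult A B = imat_mult B A'"
  shows "imat_mult (imat_pow A n) B = imat_mult B (imat_pow A' n)"
proof (induction n)
  case 0
  show ?case using assms by (simp add: imat_one_mult imat_mult_one)
next
  case (Suc n)
  have "imat_mult (imat_pow A (Suc n)) B = imat_mult (imat_pow A n) (imat_mult B A')"
    using assms by (simp add: imat_mult_assoc row_finite_pow)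
  also have "\<dots> = imat_mult (imat_mult B (imat_pow A' n)) A'"
    using assms by (simp add: row_finite_pow flip: imat_mult_assoc Suc)
  also have "\<dots> = imat_mult B (imat_pow A' (Suc n))"
    using assms by (simp add: imat_mult_assoc row_finite_pow)
  finally show ?case .
qed

definition output_matrix :: "'a::comm_ring_1 imat \<Rightarrow> 'a imat" where
  "output_matrix P = (\<lambda>n k. imat_pow P n 0 k)"

lemma row_finite_output_matrix: "row_finite P \<Longrightarrow> row_finite (output_matrix P)"
  using row_finite_pow[of P] by (simp add: row_finite_def output_matrix_def)

lemma imat_mult_output_matrix:
  "imat_mult (output_matrix P) A n k = imat_mult (imat_pow P n) A 0 k"
  by (simp add: output_matrix_def imat_mult_def)

context comm_ring_hom
begin

abbreviation hom_mat :: "'a imat \<Rightarrow> 'b imat" where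
  "hom_mat A \<equiv> (\<lambda>i j. hom (A i j))"

lemma hom_mat_one: "hom_mat imat_one = imat_one"
  by (simp add: imat_one_def fun_eq_iff)

lemma hom_mat_mult:
  assumes "row_finite A"
  shows "hom_mat (imat_mult A B) = imat_mult (hom_mat A) (hom_mat B)"
proof (intro ext)
  fix i j
  let ?S = "{l. A i l \<noteq> 0}"
  have "finite ?S" using assms by (simp add: row_finite_def)
  then show "hom (imat_mult A B i j) = imat_mult (hom_mat A) (hom_mat B) i j"
    by (subst (1 2) imat_mult_eq_sum[of ?S]) (auto simp: hom_sum hom_mult)
qed

lemma hom_mat_pow: "row_finite A \<Longrightarrow> hom_mat (imat_pow A n) = imat_pow (hom_mat A) n"
  by (induction n) (simp_all add: hom_mat_one hom_mat_mult row_finite_pow)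

lemma hom_mat_prod:
  assumes "\<And>A. A \<in> set As \<Longrightarrow> row_finite A"
  shows "hom_mat (imat_prod As) = imat_prod (map hom_mat As)"
  using assms by (induction As) (simp_all add: imat_prod_def hom_mat_one hom_mat_mult)

end

section \<open>Total positivity\<close>

lemma permutes_strict_mono_on_imp_id:
  assumes p: "p permutes {..<k}" and mono: "strict_mono_on {..<k} p"
  shows "p = (id :: nat \<Rightarrow> nat)"
proof
  fix i
  have p_strict: "strict_mono p"
  proof (rule strict_monoI)
    fix i j :: nat assume "i < j"
    then show "p i < p j"
      using strict_mono_onD[OF mono, of i j] permutes_lessThan_less[OF p, of i]
        permutes_not_in[OF p, of i] permutes_not_in[OF p, of j]
      by (cases "j < k"; cases "i < k") auto
  qed
  then have "strict_mono (inv_into UNIV p)"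
    using permutes_surj[OF p] permutes_inverses(2)[OF p] by (rule strict_mono_inv)
  then have "p i \<le> p (inv_into UNIV p i)"
    using p_strict by (simp add: strict_mono_less_eq strict_mono_imp_increasing)
  moreover have "i \<le> p i" using p_strict by (rule strict_mono_imp_increasing)
  ultimately show "p i = id i" using permutes_inverses(1)[OF p] by simp
qed

text \<open>
  Consecutive rows are supported on intervals that share at most an endpoint, so a permutation
  that contributes to a minor is increasing.
\<close>

lemma imat_minor_staircase:
  assumes "mono s" and supp: "\<And>i j. A i j \<noteq> 0 \<Longrightarrow> s i \<le> j \<and> j \<le> s (Suc i)"
    and r: "strict_mono_on {..<k} r" and c: "strict_mono_on {..<k} c"
  shows "imat_minor A k r c = (\<Prod>i<k. A (r i) (c i))"
proof -
  have "(\<Prod>i<k. A (r i) (c (p i))) = 0" if p: "p permutes {..<k}" and "p \<noteq> id" for p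
  proof (rule ccontr)
    assume "(\<Prod>i<k. A (r i) (c (p i))) \<noteq> 0"
    then have ne: "A (r i) (c (p i)) \<noteq> 0" if "i < k" for i
      using that prod_zero[of "{..<k}" "\<lambda>i. A (r i) (c (p i))"] by blast
    have "strict_mono_on {..<k} p"
    proof (rule strict_mono_onI)
      fix i j assume ij: "i \<in> {..<k}" "j \<in> {..<k}" "i < j"
      have "s (Suc (r i)) \<le> s (r j)"
        using \<open>mono s\<close> strict_mono_onD[OF r ij] by (simp add: monoD Suc_leI)
      then have "c (p i) \<le> c (p j)"
        using supp[OF ne[of i]] supp[OF ne[of j]] ij by auto
      then have "\<not> p j < p i"
        using strict_mono_onD[OF c, of "p j" "p i"] permutes_lessThan_less[OF p] ij by fastforce
      moreover have "p i \<noteq> p j" using injD[OF permutes_inj[OF p], of i j] ij by auto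
      ultimately show "p i < p j" by simp
    qed
    then show False using permutes_strict_mono_on_imp_id[OF p] \<open>p \<noteq> id\<close> by simp
  qed
  then have "imat_minor A k r c = (\<Sum>p\<in>{id}. signof p * (\<Prod>i<k. A (r i) (c (p i))))"
    unfolding imat_minor_leibniz
    by (intro sum.mono_neutral_right) (auto simp: permutes_id finite_permutations)
  then show ?thesis by simp
qed

text \<open>Unlike \<^const>\<open>imat_mult\<close>, this relation is symmetric under transposition.\<close>

definition is_product :: "'a::comm_ring_1 imat \<Rightarrow> 'a imat \<Rightarrow> 'a imat \<Rightarrow> bool" where
  "is_product A B C \<longleftrightarrow> (\<forall>i j. \<forall>\<^sub>F n in sequentially. C i j = (\<Sum>l<n. A i l * B l j))"

lemma is_product_transpose:
  "is_product A B C \<Longrightarrow> is_product (\<lambda>i j. B j i) (\<lambda>i j. A j i) (\<lambda>i j. C j i)"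
  by (simp add: is_product_def mult.commute)

lemma is_product_imat_mult:
  assumes "row_finite A"
  shows "is_product A B (imat_mult A B)"
  unfolding is_product_def
proof (intro allI)
  fix i j
  have "finite {l. A i l \<noteq> 0}" using assms by (simp add: row_finite_def)
  then obtain n0 where "A i l = 0" if "n0 \<le> l" for l
    unfolding finite_nat_set_iff_bounded using leD by blast
  then have "imat_mult A B i j = (\<Sum>l<n. A i l * B l j)" if "n0 \<le> n" for n
    using that by (intro imat_mult_eq_sum) auto
  then show "\<forall>\<^sub>F n in sequentially. imat_mult A B i j = (\<Sum>l<n. A i l * B l j)"
    by (auto simp: eventually_sequentially)
qed

locale subsemiring =
  fixes N :: "'a::comm_ring_1 set"
  assumes zero_mem: "0 \<in> N" and one_mem: "1 \<in> N"
    and add_mem: "x \<in> N \<Longrightarrow> y \<in> N \<Longrightarrow> x + y \<in> N"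
    and mult_mem: "x \<in> N \<Longrightarrow> y \<in> N \<Longrightarrow> x * y \<in> N"
begin

lemma sum_mem: "(\<And>i. i \<in> I \<Longrightarrow> f i \<in> N) \<Longrightarrow> sum f I \<in> N"
  by (induction I rule: infinite_finite_induct) (auto intro: zero_mem add_mem)

lemma prod_mem: "(\<And>i. i \<in> I \<Longrightarrow> f i \<in> N) \<Longrightarrow> prod f I \<in> N"
  by (induction I rule: infinite_finite_induct) (auto intro: one_mem mult_mem)

lemma of_nat_mem: "of_nat n \<in> N"
  by (induction n) (auto intro: zero_mem one_mem add_mem)

definition tot_pos :: "'a imat \<Rightarrow> bool" where
  "tot_pos A \<longleftrightarrow> (\<forall>k r c. strict_mono_on {..<k} r \<longrightarrow> strict_mono_on {..<k} c \<longrightarrow>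
     imat_minor A k r c \<in> N)"

lemma tot_posI:
  "(\<And>k r c. strict_mono_on {..<k} r \<Longrightarrow> strict_mono_on {..<k} c \<Longrightarrow> imat_minor A k r c \<in> N) \<Longrightarrow>
    tot_pos A"
  by (auto simp: tot_pos_def)

lemma tot_posD:
  "tot_pos A \<Longrightarrow> strict_mono_on {..<k} r \<Longrightarrow> strict_mono_on {..<k} c \<Longrightarrow> imat_minor A k r c \<in> N"
  by (auto simp: tot_pos_def)

lemma tot_pos_transpose: "tot_pos A \<Longrightarrow> tot_pos (\<lambda>i j. A j i)"
  unfolding tot_pos_def by (subst imat_minor_transpose) blast

lemma tot_pos_scale:
  assumes "tot_pos A" "\<And>i. x i \<in> N" "\<And>j. y j \<in> N"
  shows "tot_pos (\<lambda>i j. x i * A i j * y j)"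
  unfolding tot_pos_def imat_minor_scale
  using assms by (auto intro!: mult_mem prod_mem tot_posD)

lemma tot_pos_staircase:
  assumes "\<And>i j. A i j \<in> N" and "mono s"
    and "\<And>i j. A i j \<noteq> 0 \<Longrightarrow> s i \<le> j \<and> j \<le> s (Suc i)"
  shows "tot_pos A"
  by (rule tot_posI, subst imat_minor_staircase) (use assms in \<open>auto intro: prod_mem\<close>)

lemma imat_minor_product_mem:
  assumes C: "is_product A B C"
    and A: "\<And>e. strict_mono_on {..<k} e \<Longrightarrow> imat_minor A k r e \<in> N"
    and B: "tot_pos B" and c: "strict_mono_on {..<k} c"
  shows "imat_minor C k r c \<in> N"
proof -
  have "\<forall>\<^sub>F n in sequentially. \<forall>i\<in>{..<k}. \<forall>j\<in>{..<k}. C (r i) (c j) = (\<Sum>l<n. A (r i) l * B l (c j))"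
    using C by (intro eventually_ball_finite ballI) (auto simp: is_product_def)
  then obtain n where "C (r i) (c j) = (\<Sum>l<n. A (r i) l * B l (c j))" if "i < k" "j < k" for i j
    by (auto simp: eventually_sequentially)
  then have sum: "imat_minor C k r c = (\<Sum>S | S \<subseteq> {..<n} \<and> card S = k.
      imat_minor A k r (enumerate S) * imat_minor B k (enumerate S) c)"
    by (rule imat_minor_cauchy_binet)
  have "strict_mono_on {..<k} (enumerate S)" if "S \<subseteq> {..<n}" "card S = k" for S
    using that finite_subset[OF that(1)] by (auto intro!: strict_mono_onI finite_enumerate_mono)
  then show ?thesis
    unfolding sum by (intro sum_mem mult_mem A tot_posD[OF B] c) auto
qed

lemma tot_pos_product:
  assumes "is_product A B C" "tot_pos A" "tot_pos B"
  shows "tot_pos C"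
  by (rule tot_posI, rule imat_minor_product_mem[OF assms(1)]) (use assms in \<open>auto intro: tot_posD\<close>)

lemma tot_pos_imat_mult: "row_finite A \<Longrightarrow> tot_pos A \<Longrightarrow> tot_pos B \<Longrightarrow> tot_pos (imat_mult A B)"
  using is_product_imat_mult tot_pos_product by blast

lemma imat_minor_mem_if_positive_rows:
  assumes W0: "\<And>j. W 0 j = (if j = 0 then 1 else 0)"
    and pos: "\<And>k r c. strict_mono_on {..<k} r \<Longrightarrow> strict_mono_on {..<k} c \<Longrightarrow>
      (\<And>i. i < k \<Longrightarrow> 0 < r i \<and> r i < n) \<Longrightarrow> imat_minor W k r c \<in> N"
    and r: "strict_mono_on {..<k} r" and c: "strict_mono_on {..<k} c"
    and bound: "\<And>i. i < k \<Longrightarrow> r i < n"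
  shows "imat_minor W k r c \<in> N"
proof (cases "0 < k \<and> r 0 = 0")
  case True
  then obtain k' where k: "k = Suc k'" by (cases k) auto
  have "0 < c j" if "0 < j" "j \<le> k'" for j
    using strict_mono_onD[OF c, of 0 j] that k by simp
  then have "imat_minor W k r c = W 0 (c 0) * imat_minor W k' (\<lambda>i. r (Suc i)) (\<lambda>j. c (Suc j))"
    unfolding k using True by (subst imat_minor_expand_row_single) (auto simp: W0)
  moreover have "imat_minor W k' (\<lambda>i. r (Suc i)) (\<lambda>j. c (Suc j)) \<in> N"
  proof (rule pos)
    show "strict_mono_on {..<k'} (\<lambda>i. r (Suc i))" "strict_mono_on {..<k'} (\<lambda>j. c (Suc j))"
      using r c k by (auto simp: strict_mono_on_def)
    show "0 < r (Suc i) \<and> r (Suc i) < n" if "i < k'" for i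
      using strict_mono_onD[OF r, of 0 "Suc i"] bound[of "Suc i"] that k by simp
  qed
  ultimately show ?thesis by (simp add: W0 zero_mem)
next
  case False
  have "0 < r i" if "i < k" for i
    using strict_mono_onD[OF r, of 0 i] that False by (cases "i = 0") auto
  then show ?thesis using r c bound by (intro pos conjI)
qed

lemma tot_pos_iterated_rows:
  assumes P: "tot_pos P" and W0: "\<And>j. W 0 j = (if j = 0 then 1 else 0)"
    and WS: "is_product W P (\<lambda>i. W (Suc i))"
  shows "tot_pos W"
proof -
  have bounded: "imat_minor W k r c \<in> N"
    if "strict_mono_on {..<k} r" "strict_mono_on {..<k} c" "\<And>i. i < k \<Longrightarrow> r i < n" for n k r c
    using that
  proof (induction n arbitrary: k r c)
    case 0
    then show ?case by (cases k) (auto simp: one_mem)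
  next
    case (Suc n)
    have "imat_minor W k r c \<in> N"
      if r: "strict_mono_on {..<k} r" and c: "strict_mono_on {..<k} c"
        and bounds: "\<And>i. i < k \<Longrightarrow> 0 < r i \<and> r i < Suc n" for k r c
    proof -
      have "r i - 1 < r j - 1" if "i < j" "j < k" for i j
        using strict_mono_onD[OF r, of i j] bounds[of i] that by (simp add: diff_less_mono)
      then have "strict_mono_on {..<k} (\<lambda>i. r i - 1)" by (simp add: strict_mono_on_def)
      moreover have "r i - 1 < n" if "i < k" for i using bounds[OF that] by linarith
      ultimately have "imat_minor W k (\<lambda>i. r i - 1) e \<in> N" if "strict_mono_on {..<k} e" for e
        using that by (intro Suc.IH)
      then have "imat_minor (\<lambda>i. W (Suc i)) k (\<lambda>i. r i - 1) c \<in> N"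
        by (rule imat_minor_product_mem[OF WS _ P c])
      also have "imat_minor (\<lambda>i. W (Suc i)) k (\<lambda>i. r i - 1) c = imat_minor W k r c"
        using bounds by (intro imat_minor_cong) simp
      finally show ?thesis .
    qed
    then show ?case using Suc.prems by (rule imat_minor_mem_if_positive_rows[where W = W, OF W0])
  qed
  show ?thesis
  proof (rule tot_posI)
    fix k and r c :: "nat \<Rightarrow> nat"
    assume "strict_mono_on {..<k} r" "strict_mono_on {..<k} c"
    then show "imat_minor W k r c \<in> N"
      by (rule bounded[where n = "Suc (\<Sum>i<k. r i)"])
        (auto simp: less_Suc_eq_le intro!: member_le_sum)
  qed
qed

theorem tot_pos_hankel:
  assumes fin: "row_finite P" and P: "tot_pos P"
  shows "tot_pos (\<lambda>i j. imat_pow P (i + j) 0 0)"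
proof -
  let ?W = "output_matrix P"
  define V where "V k n = imat_pow P n k 0" for k n
  have "(\<lambda>n. ?W (Suc n)) = imat_mult ?W P"
    by (simp add: imat_mult_output_matrix fun_eq_iff) (simp add: output_matrix_def)
  then have "is_product ?W P (\<lambda>n. ?W (Suc n))"
    using is_product_imat_mult[OF row_finite_output_matrix[OF fin]] by simp
  then have W: "tot_pos ?W"
    using P by (rule tot_pos_iterated_rows[rotated 2]) (simp add: output_matrix_def imat_one_def)
  have "(\<lambda>k n. V k (Suc n)) = imat_mult P V"
    by (simp add: V_def imat_pow_Suc_left[OF fin] imat_mult_def fun_eq_iff del: imat_pow.simps)
  then have "is_product P V (\<lambda>k n. V k (Suc n))"
    using is_product_imat_mult[OF fin] by simp
  then have "is_product (\<lambda>n k. V k n) (\<lambda>i j. P j i) (\<lambda>n k. V k (Suc n))"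
    by (rule is_product_transpose)
  then have "tot_pos (\<lambda>n k. V k n)"
    using tot_pos_transpose[OF P]
    by (rule tot_pos_iterated_rows[rotated 2]) (simp add: V_def imat_one_def)
  then have V: "tot_pos V" by (rule tot_pos_transpose)
  have "(\<lambda>i j. imat_pow P (i + j) 0 0) = imat_mult ?W V"
    by (simp add: imat_mult_output_matrix imat_pow_add[OF fin] fun_eq_iff)
      (simp add: imat_mult_def V_def)
  then show ?thesis using tot_pos_imat_mult[OF row_finite_output_matrix[OF fin] W V] by simp
qed

end

section \<open>Conjugation by the binomial matrix\<close>

definition binomial_mat :: "'a::comm_ring_1 \<Rightarrow> 'a imat" where
  "binomial_mat q = (\<lambda>i j. of_nat (i choose j) * q ^ (i - j))"

definition derivative_mat :: "'a::comm_ring_1 imat" where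
  "derivative_mat = (\<lambda>i j. if i = Suc j then of_nat i else 0)"

definition upper_bidiagonal :: "'a::comm_ring_1 \<Rightarrow> 'a \<Rightarrow> 'a imat" where
  "upper_bidiagonal d e = (\<lambda>i j. if j = i then d else if j = Suc i then e else 0)"

text \<open>Conjugation is stated as an intertwining relation, so that no inverse is needed.\<close>

definition binomial_conjugate :: "'a::comm_ring_1 \<Rightarrow> 'a imat \<Rightarrow> 'a imat \<Rightarrow> bool" where
  "binomial_conjugate q A A' \<longleftrightarrow> row_finite A \<and> row_finite A' \<and>
     imat_mult A (binomial_mat q) = imat_mult (binomial_mat q) A'"

lemma row_finite_binomial_mat: "row_finite (binomial_mat q)"
  by (rule row_finiteI[where b = id]) (simp add: binomial_mat_def binomial_eq_0)

lemma row_finite_derivative_mat: "row_finite derivative_mat"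
  by (rule row_finiteI[where b = id]) (simp add: derivative_mat_def)

lemma row_finite_upper_bidiagonal: "row_finite (upper_bidiagonal d e)"
  by (rule row_finiteI[where b = Suc]) (simp add: upper_bidiagonal_def)

lemma row_finite_Lmat: "row_finite (Lmat a b c)"
  by (rule row_finiteI[where b = id]) (simp add: Lmat_def)

lemma row_finite_Jmat: "row_finite (Jmat a b u v lam)"
  by (rule row_finiteI[where b = Suc]) (simp add: Jmat_def)

lemma imat_mult_derivative_mat: "imat_mult derivative_mat A i j = of_nat i * A (i - 1) j"
proof (cases i)
  case 0
  then show ?thesis by (simp add: imat_mult_eq_sum[of "{}"] derivative_mat_def)
next
  case (Suc i')
  then show ?thesis by (subst imat_mult_eq_sum[of "{i'}"]) (auto simp: derivative_mat_def)
qed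

lemma imat_mult_upper_bidiagonal:
  "imat_mult (upper_bidiagonal d e) A i j = d * A i j + e * A (Suc i) j"
  by (subst imat_mult_eq_sum[of "{i, Suc i}"]) (auto simp: upper_bidiagonal_def)

lemma Lmat_decompose:
  "Lmat a b c = (\<lambda>i j. imat_mult derivative_mat (upper_bidiagonal c a) i j + b * imat_one i j)"
proof (intro ext)
  fix i j
  show "Lmat a b c i j = imat_mult derivative_mat (upper_bidiagonal c a) i j + b * imat_one i j"
    by (cases i) (auto simp: imat_mult_derivative_mat Lmat_def upper_bidiagonal_def imat_one_def)
qed

lemma imat_mult_Lmat:
  "imat_mult (Lmat a b c) A i j = of_nat i * c * A (i - 1) j + (of_nat i * a + b) * A i j"
proof (cases i)
  case 0
  then show ?thesis by (subst imat_mult_eq_sum[of "{0}"]) (auto simp: Lmat_def)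
next
  case (Suc i')
  then show ?thesis by (subst imat_mult_eq_sum[of "{i', i}"]) (auto simp: Lmat_def)
qed

lemma Jmat_decompose:
  "Jmat a b u v lam = (\<lambda>i j.
     imat_mult (Lmat u (u + v) (lam * u + a)) (upper_bidiagonal lam 1) i j + b * imat_one i j)"
proof (intro ext)
  fix i j
  show "Jmat a b u v lam i j =
      imat_mult (Lmat u (u + v) (lam * u + a)) (upper_bidiagonal lam 1) i j + b * imat_one i j"
    by (cases i)
      (auto simp: imat_mult_Lmat Jmat_def upper_bidiagonal_def imat_one_def algebra_simps)
qed

lemma binomial_conjugate_mult:
  assumes "binomial_conjugate q A A'" "binomial_conjugate q B B'"
  shows "binomial_conjugate q (imat_mult A B) (imat_mult A' B')"
proof -
  let ?C = "binomial_mat q"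
  have A: "row_finite A" "row_finite A'" "imat_mult A ?C = imat_mult ?C A'"
    and B: "row_finite B" "row_finite B'" "imat_mult B ?C = imat_mult ?C B'"
    using assms by (simp_all add: binomial_conjugate_def)
  have "imat_mult (imat_mult A B) ?C = imat_mult A (imat_mult ?C B')"
    by (simp only: imat_mult_assoc[OF A(1) B(1)] B(3))
  also have "\<dots> = imat_mult (imat_mult ?C A') B'"
    by (simp only: imat_mult_assoc[OF A(1) row_finite_binomial_mat, symmetric] A(3))
  also have "\<dots> = imat_mult ?C (imat_mult A' B')"
    by (rule imat_mult_assoc[OF row_finite_binomial_mat A(2)])
  finally show ?thesis using A B by (simp add: binomial_conjugate_def row_finite_mult)
qed

lemma binomial_conjugate_add_scalar:
  assumes "binomial_conjugate q A A'"
  shows "binomial_conjugate q (\<lambda>i j. A i j + b * imat_one i j) (\<lambda>i j. A' i j + b * imat_one i j)"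
  using assms
  by (simp add: binomial_conjugate_def row_finite_add row_finite_scalar imat_mult_add_left
      imat_mult_add_right imat_scalar_mult imat_mult_scalar row_finite_binomial_mat)

lemma binomial_conjugate_one: "binomial_conjugate q imat_one imat_one"
  by (simp add: binomial_conjugate_def row_finite_one imat_one_mult imat_mult_one
      row_finite_binomial_mat)

lemma binomial_conjugate_derivative_mat: "binomial_conjugate q derivative_mat derivative_mat"
proof -
  have "of_nat i * binomial_mat q (i - 1) j = binomial_mat q i (Suc j) * of_nat (Suc j)" for i j
  proof (cases i)
    case (Suc i')
    have "of_nat i * binomial_mat q (i - 1) j = of_nat (Suc i' * (i' choose j)) * q ^ (i' - j)"
      by (simp only: Suc binomial_mat_def diff_Suc_1 mult.assoc of_nat_mult)
    also have "\<dots> = binomial_mat q i (Suc j) * of_nat (Suc j)"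
      unfolding Suc_times_binomial_eq
      by (simp only: Suc binomial_mat_def diff_Suc_Suc of_nat_mult) (simp only: mult_ac)
    finally show ?thesis .
  qed (simp add: binomial_mat_def)
  moreover have "imat_mult (binomial_mat q) derivative_mat i j =
      binomial_mat q i (Suc j) * of_nat (Suc j)" for i j
    by (subst imat_mult_eq_sum_col[of _ "{Suc j}"])
      (auto simp: row_finite_binomial_mat derivative_mat_def)
  ultimately show ?thesis
    by (simp add: binomial_conjugate_def row_finite_derivative_mat imat_mult_derivative_mat
        fun_eq_iff)
qed

lemma binomial_mat_Suc_0: "binomial_mat q (Suc i) 0 = q * binomial_mat q i 0"
  by (simp add: binomial_mat_def)

lemma binomial_mat_Suc_Suc:
  "binomial_mat q (Suc i) (Suc j) = binomial_mat q i j + q * binomial_mat q i (Suc j)"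
proof (cases "Suc j \<le> i")
  case True
  then have "i - j = Suc (i - Suc j)" by simp
  then show ?thesis by (simp add: binomial_mat_def algebra_simps)
qed (simp add: binomial_mat_def binomial_eq_0)

lemma binomial_conjugate_upper_bidiagonal:
  "binomial_conjugate q (upper_bidiagonal d e) (upper_bidiagonal (d + q * e) e)"
proof -
  have "imat_mult (upper_bidiagonal d e) (binomial_mat q) i j =
      imat_mult (binomial_mat q) (upper_bidiagonal (d + q * e) e) i j" for i j
  proof (cases j)
    case 0
    have "imat_mult (binomial_mat q) (upper_bidiagonal (d + q * e) e) i 0 =
        binomial_mat q i 0 * (d + q * e)"
      by (subst imat_mult_eq_sum_col[of _ "{0}"])
        (auto simp: row_finite_binomial_mat upper_bidiagonal_def)
    then show ?thesis
      by (simp add: 0 imat_mult_upper_bidiagonal binomial_mat_Suc_0 algebra_simps)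
  next
    case (Suc j')
    have "imat_mult (binomial_mat q) (upper_bidiagonal (d + q * e) e) i (Suc j') =
        binomial_mat q i j' * e + binomial_mat q i (Suc j') * (d + q * e)"
      by (subst imat_mult_eq_sum_col[of _ "{j', Suc j'}"])
        (auto simp: row_finite_binomial_mat upper_bidiagonal_def)
    then show ?thesis
      by (simp add: Suc imat_mult_upper_bidiagonal binomial_mat_Suc_Suc algebra_simps)
  qed
  then show ?thesis
    by (simp add: binomial_conjugate_def row_finite_upper_bidiagonal fun_eq_iff)
qed

lemma binomial_conjugate_Lmat: "binomial_conjugate q (Lmat a b c) (Lmat a b (c + q * a))"
  unfolding Lmat_decompose
  by (intro binomial_conjugate_add_scalar binomial_conjugate_mult
      binomial_conjugate_derivative_mat binomial_conjugate_upper_bidiagonal)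

lemma binomial_conjugate_Jmat:
  "binomial_conjugate q (Jmat a b u v lam) (Jmat a b u v (lam + q))"
proof -
  have "binomial_conjugate q (Lmat u (u + v) (lam * u + a)) (Lmat u (u + v) ((lam + q) * u + a))"
    using binomial_conjugate_Lmat[of q u "u + v" "lam * u + a"] by (simp add: algebra_simps)
  moreover have "binomial_conjugate q (upper_bidiagonal lam 1) (upper_bidiagonal (lam + q) 1)"
    using binomial_conjugate_upper_bidiagonal[of q lam 1] by simp
  ultimately show ?thesis
    unfolding Jmat_decompose by (intro binomial_conjugate_add_scalar binomial_conjugate_mult)
qed

locale real_scalars = comm_ring_hom \<kappa> for \<kappa> :: "real \<Rightarrow> 'a::comm_ring_1"
begin

definition gamma_mat :: "'a fps \<Rightarrow> 'a imat" where
  "gamma_mat f = (\<lambda>i j. \<kappa> (fact i / fact j) * toeplitz f i j)"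

lemma row_finite_gamma_mat: "row_finite (gamma_mat f)"
  by (rule row_finiteI[where b = id]) (simp add: gamma_mat_def toeplitz_def)

lemma toeplitz_mult_nth:
  assumes "j \<le> i"
  shows "(\<Sum>l=j..i. fps_nth f (i - l) * fps_nth g (l - j)) = fps_nth (f * g) (i - j)"
  unfolding fps_mult_nth using assms
  by (intro sum.reindex_bij_witness[where i = "\<lambda>m. i - m" and j = "\<lambda>l. i - l"]) auto

lemma gamma_mat_mult: "imat_mult (gamma_mat f) (gamma_mat g) = gamma_mat (f * g)"
proof (intro ext)
  fix i j
  have "imat_mult (gamma_mat f) (gamma_mat g) i j = (\<Sum>l\<le>i. gamma_mat f i l * gamma_mat g l j)"
    by (rule imat_mult_eq_sum) (auto simp: gamma_mat_def toeplitz_def)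
  also have "\<dots> = (\<Sum>l=j..i. gamma_mat f i l * gamma_mat g l j)"
    by (rule sum.mono_neutral_right) (auto simp: gamma_mat_def toeplitz_def)
  also have "\<dots> = (\<Sum>l=j..i. \<kappa> (fact i / fact j) * (fps_nth f (i - l) * fps_nth g (l - j)))"
  proof (rule sum.cong[OF refl])
    fix l assume "l \<in> {j..i}"
    moreover have "\<kappa> (fact i / fact j) = \<kappa> (fact i / fact l) * \<kappa> (fact l / fact j)"
      by (simp flip: hom_mult)
    ultimately show "gamma_mat f i l * gamma_mat g l j =
        \<kappa> (fact i / fact j) * (fps_nth f (i - l) * fps_nth g (l - j))"
      by (simp add: gamma_mat_def toeplitz_def mult_ac)
  qed
  also have "\<dots> = gamma_mat (f * g) i j"
    by (cases "j \<le> i")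
      (simp_all add: gamma_mat_def toeplitz_def toeplitz_mult_nth flip: sum_distrib_left)
  finally show "imat_mult (gamma_mat f) (gamma_mat g) i j = gamma_mat (f * g) i j" .
qed

lemma binomial_mat_eq_gamma_mat:
  "binomial_mat q = gamma_mat (Abs_fps (\<lambda>n. \<kappa> (1 / fact n) * q ^ n))"
proof (intro ext)
  fix i j
  show "binomial_mat q i j = gamma_mat (Abs_fps (\<lambda>n. \<kappa> (1 / fact n) * q ^ n)) i j"
  proof (cases "j \<le> i")
    case True
    then have "of_nat (i choose j) = \<kappa> (fact i / fact j) * \<kappa> (1 / fact (i - j))"
      by (simp add: binomial_fact flip: hom_of_nat hom_mult)
    then show ?thesis
      using True by (simp add: binomial_mat_def gamma_mat_def toeplitz_def mult_ac)
  qed (simp add: binomial_mat_def gamma_mat_def toeplitz_def binomial_eq_0)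
qed

lemma binomial_conjugate_gamma_mat: "binomial_conjugate q (gamma_mat f) (gamma_mat f)"
  by (simp add: binomial_conjugate_def row_finite_gamma_mat binomial_mat_eq_gamma_mat
      gamma_mat_mult mult.commute)

end

section \<open>Totally positive binomial conjugates\<close>

text \<open>
  A tridiagonal matrix of the form \<open>L U + b\<close>, where \<open>L\<close> has diagonal \<open>l\<close> and subdiagonal \<open>m\<close>,
  \<open>U\<close> has diagonal \<open>d\<close> and superdiagonal \<open>e\<close> and \<open>b\<close> is diagonal, is the product of the block row
  \<open>(L, b)\<close> and the block column \<open>(U, I)\<close>.  Interleaving the columns of the two blocks turns both
  factors into staircase matrices.
\<close>

definition interleaved_block_row ::
    "(nat \<Rightarrow> 'a::comm_ring_1) \<Rightarrow> (nat \<Rightarrow> 'a) \<Rightarrow> (nat \<Rightarrow> 'a) \<Rightarrow> 'a imat" where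
  "interleaved_block_row l m b = (\<lambda>n k. if k = 2 * n then m n else if k = 2 * n + 1 then b n
     else if k = 2 * n + 2 then l n else 0)"

definition interleaved_block_column ::
    "(nat \<Rightarrow> 'a::comm_ring_1) \<Rightarrow> (nat \<Rightarrow> 'a) \<Rightarrow> 'a imat" where
  "interleaved_block_column d e = (\<lambda>k j. if k = 2 * j then e (j - 1) else if k = 2 * j + 1 then 1
     else if k = 2 * j + 2 then d j else 0)"

lemma row_finite_interleaved_block_row: "row_finite (interleaved_block_row l m b)"
  by (rule row_finiteI[where b = "\<lambda>n. 2 * n + 2"]) (simp add: interleaved_block_row_def)

lemma imat_mult_interleaved_blocks:
  assumes "m 0 = 0"
  shows "imat_mult (interleaved_block_row l m b) (interleaved_block_column d e) =
    (\<lambda>n j. if j = Suc n then l n * e n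
      else if j = n then l n * d n + m n * e (n - 1) + b n
      else if n = Suc j then m n * d j else 0)" (is "imat_mult ?X ?Y = ?T")
proof (intro ext)
  fix n j
  have "imat_mult ?X ?Y n j = (\<Sum>k\<in>{2 * n, 2 * n + 1, 2 * n + 2}. ?X n k * ?Y k j)"
    by (rule imat_mult_eq_sum) (auto simp: interleaved_block_row_def)
  also have "\<dots> = m n * ?Y (2 * n) j + b n * ?Y (2 * n + 1) j + l n * ?Y (2 * n + 2) j"
    by (simp add: interleaved_block_row_def add_ac)
  also have "\<dots> = ?T n j"
  proof -
    consider "j = Suc n" | "j = n" | "n = Suc j" | "j \<noteq> Suc n" "j \<noteq> n" "n \<noteq> Suc j" by blast
    then show ?thesis
    proof cases
      case 4
      then have "2 * n \<noteq> 2 * j + 2" "2 * n + 2 \<noteq> 2 * j" "2 * n + 1 \<noteq> 2 * j + 2"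
        "2 * n + 1 \<noteq> 2 * j" "2 * n \<noteq> 2 * j + 1" "2 * n + 2 \<noteq> 2 * j + 1"
        by presburger+
      then show ?thesis using 4 by (simp add: interleaved_block_column_def)
    qed (simp_all add: interleaved_block_column_def assms algebra_simps)
  qed
  finally show "imat_mult ?X ?Y n j = ?T n j" .
qed

context subsemiring
begin

lemma tot_pos_one: "tot_pos imat_one"
  by (rule tot_pos_staircase[where s = id])
    (auto simp: imat_one_def zero_mem one_mem mono_def split: if_splits)

lemma tot_pos_Lmat:
  assumes "a \<in> N" "b \<in> N" "c \<in> N"
  shows "tot_pos (Lmat a b c)"
proof (rule tot_pos_staircase[where s = "\<lambda>i. i - 1"])
  show "mono (\<lambda>i::nat. i - 1)" by (auto intro: monoI)
qed (use assms in \<open>auto simp: Lmat_def intro!: add_mem mult_mem of_nat_mem zero_mem one_mem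
      split: if_splits\<close>)

lemma tot_pos_tridiagonal:
  fixes l m d e b :: "nat \<Rightarrow> 'a"
  assumes mem: "\<And>n. l n \<in> N" "\<And>n. m n \<in> N" "\<And>n. d n \<in> N" "\<And>n. e n \<in> N" "\<And>n. b n \<in> N"
    and "m 0 = 0"
  shows "tot_pos (\<lambda>n j. if j = Suc n then l n * e n
    else if j = n then l n * d n + m n * e (n - 1) + b n
    else if n = Suc j then m n * d j else 0)"
proof -
  have mono: "mono (\<lambda>n::nat. 2 * n)" by (auto intro: monoI)
  have "tot_pos (interleaved_block_row l m b)"
    by (rule tot_pos_staircase[OF _ mono])
      (use mem in \<open>auto simp: interleaved_block_row_def zero_mem split: if_splits\<close>)
  moreover have "tot_pos (\<lambda>j k. interleaved_block_column d e k j)"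
    by (rule tot_pos_staircase[OF _ mono])
      (use mem in \<open>auto simp: interleaved_block_column_def zero_mem one_mem split: if_splits\<close>)
  then have "tot_pos (interleaved_block_column d e)" by (rule tot_pos_transpose)
  ultimately have "tot_pos (imat_mult (interleaved_block_row l m b) (interleaved_block_column d e))"
    by (rule tot_pos_imat_mult[OF row_finite_interleaved_block_row])
  then show ?thesis unfolding imat_mult_interleaved_blocks[of m, OF assms(6)] .
qed

lemma tot_pos_Jmat:
  assumes "a \<in> N" "b \<in> N" "u \<in> N" "v \<in> N" "lam \<in> N"
  shows "tot_pos (Jmat a b u v lam)"
proof -
  have "tot_pos (\<lambda>n j. if j = Suc n then (u * of_nat n + u + v) * 1
      else if j = n then (u * of_nat n + u + v) * lam + (lam * u + a) * of_nat n * 1 + b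
      else if n = Suc j then (lam * u + a) * of_nat n * lam else 0)"
    by (rule tot_pos_tridiagonal[where l = "\<lambda>n. u * of_nat n + u + v"
          and m = "\<lambda>n. (lam * u + a) * of_nat n" and d = "\<lambda>_. lam" and e = "\<lambda>_. 1" and b = "\<lambda>_. b"])
      (use assms in \<open>auto intro!: add_mem mult_mem of_nat_mem one_mem\<close>)
  also have "(\<lambda>n j. if j = Suc n then (u * of_nat n + u + v) * 1
      else if j = n then (u * of_nat n + u + v) * lam + (lam * u + a) * of_nat n * 1 + b
      else if n = Suc j then (lam * u + a) * of_nat n * lam else 0) = Jmat a b u v lam"
    by (auto simp: Jmat_def fun_eq_iff algebra_simps)
  finally show ?thesis .
qed

definition binomial_positive :: "'a \<Rightarrow> 'a imat \<Rightarrow> bool" where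
  "binomial_positive q A \<longleftrightarrow> (\<exists>A'. binomial_conjugate q A A' \<and> tot_pos A')"

lemma binomial_positive_mult:
  assumes "binomial_positive q A" "binomial_positive q B"
  shows "binomial_positive q (imat_mult A B)"
proof -
  obtain A' B' where A: "binomial_conjugate q A A'" "tot_pos A'"
    and B: "binomial_conjugate q B B'" "tot_pos B'"
    using assms by (auto simp: binomial_positive_def)
  have "row_finite A'" using A(1) by (simp add: binomial_conjugate_def)
  then have "tot_pos (imat_mult A' B')" using A(2) B(2) by (rule tot_pos_imat_mult)
  then show ?thesis
    using binomial_conjugate_mult[OF A(1) B(1)] by (auto simp: binomial_positive_def)
qed

lemma binomial_positive_prod:
  "(\<And>A. A \<in> set As \<Longrightarrow> binomial_positive q A) \<Longrightarrow> binomial_positive q (imat_prod As)"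
proof (induction As)
  case Nil
  then show ?case
    using binomial_conjugate_one tot_pos_one by (auto simp: imat_prod_def binomial_positive_def)
next
  case (Cons A As)
  then show ?case using binomial_positive_mult[of q A "imat_prod As"] by (simp add: imat_prod_def)
qed

lemma binomial_positive_Lmat:
  assumes "q \<in> N" "a \<in> N" "b \<in> N" "c \<in> N"
  shows "binomial_positive q (Lmat a b c)"
  unfolding binomial_positive_def
  by (rule exI, rule conjI[OF binomial_conjugate_Lmat]) (intro tot_pos_Lmat add_mem mult_mem assms)

lemma binomial_positive_Jmat:
  assumes "q \<in> N" "a \<in> N" "b \<in> N" "u \<in> N" "v \<in> N" "lam \<in> N"
  shows "binomial_positive q (Jmat a b u v lam)"
  unfolding binomial_positive_def
  by (rule exI, rule conjI[OF binomial_conjugate_Jmat]) (intro tot_pos_Jmat add_mem assms)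

text \<open>
  The row polynomials \<open>\<Sum>\<^sub>k O\<^sub>n\<^sub>k q\<^sup>k\<close> of the output matrix \<open>O\<close> of \<open>P\<close> form the first column of its
  product with the binomial matrix \<open>B\<close>.  Row \<open>0\<close> of \<open>B\<close> is the unit vector, so that
  \<open>(P\<^sup>n B)\<^sub>0\<^sub>0 = (B Q\<^sup>n)\<^sub>0\<^sub>0 = (Q\<^sup>n)\<^sub>0\<^sub>0\<close> for the conjugate \<open>Q\<close> of \<open>P\<close>.
\<close>

theorem tot_pos_hankel_row_polynomials:
  assumes "binomial_positive q P"
  shows "tot_pos (\<lambda>i j. imat_mult (output_matrix P) (binomial_mat q) (i + j) 0)"
proof -
  obtain Q where P: "row_finite P" and Q: "row_finite Q" "tot_pos Q"
    and PQ: "imat_mult P (binomial_mat q) = imat_mult (binomial_mat q) Q"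
    using assms by (auto simp: binomial_positive_def binomial_conjugate_def)
  have "imat_mult (output_matrix P) (binomial_mat q) n 0 = imat_pow Q n 0 0" for n
  proof -
    have "imat_mult (output_matrix P) (binomial_mat q) n 0 =
        imat_mult (binomial_mat q) (imat_pow Q n) 0 0"
      unfolding imat_mult_output_matrix
        imat_pow_intertwine[OF P row_finite_binomial_mat Q(1) PQ] ..
    also have "\<dots> = imat_pow Q n 0 0"
      by (subst imat_mult_eq_sum[of "{0}"]) (auto simp: binomial_mat_def binomial_eq_0)
    finally show ?thesis .
  qed
  then show ?thesis using tot_pos_hankel[OF Q] by simp
qed

end

locale nonneg_scalars = subsemiring N + real_scalars \<kappa>
  for N :: "'a::comm_ring_1 set" and \<kappa> :: "real \<Rightarrow> 'a" +
  assumes \<kappa>_mem: "0 \<le> x \<Longrightarrow> \<kappa> x \<in> N"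
begin

lemma tot_pos_gamma_mat:
  assumes "tot_pos (toeplitz f)"
  shows "tot_pos (gamma_mat f)"
proof -
  have "tot_pos (\<lambda>i j. \<kappa> (fact i) * toeplitz f i j * \<kappa> (1 / fact j))"
    using assms by (rule tot_pos_scale) (auto intro: \<kappa>_mem)
  also have "(\<lambda>i j. \<kappa> (fact i) * toeplitz f i j * \<kappa> (1 / fact j)) = gamma_mat f"
  proof (intro ext)
    fix i j
    have "\<kappa> (fact i / fact j) = \<kappa> (fact i) * \<kappa> (1 / fact j)"
      by (simp flip: hom_mult)
    then show "\<kappa> (fact i) * toeplitz f i j * \<kappa> (1 / fact j) = gamma_mat f i j"
      by (simp add: gamma_mat_def mult_ac)
  qed
  finally show ?thesis .
qed

lemma binomial_positive_gamma_mat: "tot_pos (toeplitz f) \<Longrightarrow> binomial_positive q (gamma_mat f)"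
  unfolding binomial_positive_def using binomial_conjugate_gamma_mat tot_pos_gamma_mat by blast

end

section \<open>Jacobi--Rogers triangles\<close>

lemma luk_paths_height:
  assumes h: "h \<in> luk_paths m n k" and "i \<le> n"
  shows "h ! i \<le> i"
  using \<open>i \<le> n\<close>
proof (induction i)
  case 0
  then show ?case using h by (simp add: luk_paths_def)
next
  case (Suc i)
  then have "h ! Suc i \<le> h ! i + 1" using h by (simp add: luk_paths_def)
  then show ?case using Suc by simp
qed

lemma finite_luk_paths: "finite (luk_paths m n k)"
proof (rule finite_subset)
  show "luk_paths m n k \<subseteq> {h. set h \<subseteq> {..n} \<and> length h = Suc n}"
  proof safe
    fix h assume h: "h \<in> luk_paths m n k"
    then show len: "length h = Suc n" by (simp add: luk_paths_def)
    fix x assume "x \<in> set h"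
    then obtain i where "i \<le> n" "x = h ! i" using len by (metis in_set_conv_nth less_Suc_eq_le)
    then show "x \<le> n" using luk_paths_height[OF h, of i] by simp
  qed
qed (simp add: finite_lists_length_eq)

lemma luk_paths_Suc:
  "bij_betw (\<lambda>(j, h). h @ [k])
    (SIGMA j:{j. j \<le> n \<and> k \<le> j + 1 \<and> enat j \<le> enat k + m}. luk_paths m n j) (luk_paths m (Suc n) k)"
proof (rule bij_betw_byWitness[where f' = "\<lambda>h. (h ! n, butlast h)"])
  let ?S = "SIGMA j:{j. j \<le> n \<and> k \<le> j + 1 \<and> enat j \<le> enat k + m}. luk_paths m n j"
  show "\<forall>x\<in>?S. (\<lambda>h. (h ! n, butlast h)) ((\<lambda>(j, h). h @ [k]) x) = x"
    by (auto simp: luk_paths_def nth_append)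
  show "\<forall>h\<in>luk_paths m (Suc n) k. (\<lambda>(j, h). h @ [k]) (h ! n, butlast h) = h"
  proof
    fix h assume "h \<in> luk_paths m (Suc n) k"
    then have "length h = Suc (Suc n)" "h ! Suc n = k" by (auto simp: luk_paths_def)
    moreover from this have "h \<noteq> []" by auto
    ultimately have "last h = k" "h \<noteq> []" by (simp_all add: last_conv_nth)
    then show "(\<lambda>(j, h). h @ [k]) (h ! n, butlast h) = h" using append_butlast_last_id by fastforce
  qed
  show "(\<lambda>(j, h). h @ [k]) ` ?S \<subseteq> luk_paths m (Suc n) k"
    by (auto simp: luk_paths_def nth_append less_Suc_eq)
  show "(\<lambda>h. (h ! n, butlast h)) ` luk_paths m (Suc n) k \<subseteq> ?S"
  proof (rule image_subsetI)
    fix h assume "h \<in> luk_paths m (Suc n) k"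
    then show "(h ! n, butlast h) \<in> ?S"
      using luk_paths_height[of h m "Suc n" k n] by (auto simp: luk_paths_def nth_butlast)
  qed
qed

lemma Pmat_eq_step_weight:
  "Pmat m \<beta> j k = (if k \<le> j + 1 \<and> enat j \<le> enat k + m then step_weight m \<beta> j k else 0)"
proof -
  have "enat j \<le> enat (Suc j) + m" by (rule order_trans[of _ "enat (Suc j)"]) auto
  then show ?thesis by (auto simp: Pmat_def step_weight_def)
qed

lemma jacobi_rogers_0: "jacobi_rogers m \<beta> 0 k = (if k = 0 then 1 else 0)"
proof -
  have "luk_paths m 0 k = (if k = 0 then {[0]} else {})"
    by (auto simp: luk_paths_def length_Suc_conv)
  then show ?thesis by (simp add: jacobi_rogers_def)
qed

lemma jacobi_rogers_Suc:
  "jacobi_rogers m \<beta> (Suc n) k = (\<Sum>j\<le>n. jacobi_rogers m \<beta> n j * Pmat m \<beta> j k)"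
proof -
  define J where "J = {j. j \<le> n \<and> k \<le> j + 1 \<and> enat j \<le> enat k + m}"
  define w where "w n h = (\<Prod>i<n. step_weight m \<beta> (h ! i) (h ! Suc i))" for n h
  have w_append: "w (Suc n) (h @ [k]) = w n h * step_weight m \<beta> j k"
    if "h \<in> luk_paths m n j" for j h
    using that by (simp add: w_def luk_paths_def nth_append)
  have "finite J" by (rule finite_subset[of _ "{..n}"]) (auto simp: J_def)
  have "jacobi_rogers m \<beta> (Suc n) k =
      (\<Sum>(j, h)\<in>(SIGMA j:J. luk_paths m n j). w (Suc n) (h @ [k]))"
    unfolding jacobi_rogers_def w_def[symmetric] J_def
    by (subst sum.reindex_bij_betw[OF luk_paths_Suc, symmetric]) (simp add: case_prod_beta)
  also have "\<dots> = (\<Sum>j\<in>J. \<Sum>h\<in>luk_paths m n j. w n h * step_weight m \<beta> j k)"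
    using \<open>finite J\<close> finite_luk_paths by (subst sum.Sigma) (auto simp: w_append intro!: sum.cong)
  also have "\<dots> = (\<Sum>j\<in>J. jacobi_rogers m \<beta> n j * step_weight m \<beta> j k)"
    by (simp add: jacobi_rogers_def w_def sum_distrib_right)
  also have "\<dots> = (\<Sum>j\<le>n. jacobi_rogers m \<beta> n j * Pmat m \<beta> j k)"
    by (intro sum.mono_neutral_cong_left) (auto simp: J_def Pmat_eq_step_weight)
  finally show ?thesis .
qed

lemma jacobi_rogers_eq_0:
  assumes "n < k"
  shows "jacobi_rogers m \<beta> n k = 0"
proof -
  have "k \<le> n" if "h \<in> luk_paths m n k" for h
    using luk_paths_height[OF that order_refl] that by (simp add: luk_paths_def)
  then have "luk_paths m n k = {}" using assms by fastforce
  then show ?thesis by (simp add: jacobi_rogers_def)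
qed

lemma row_finite_Pmat: "row_finite (Pmat m \<beta>)"
  by (rule row_finiteI[where b = Suc]) (simp add: Pmat_def)

theorem jacobi_rogers_eq_output_matrix: "jacobi_rogers m \<beta> = output_matrix (Pmat m \<beta>)"
proof (intro ext)
  fix n k
  show "jacobi_rogers m \<beta> n k = output_matrix (Pmat m \<beta>) n k"
  proof (induction n arbitrary: k)
    case 0
    then show ?case by (simp add: jacobi_rogers_0 output_matrix_def imat_one_def)
  next
    case (Suc n)
    have "output_matrix (Pmat m \<beta>) (Suc n) k = imat_mult (output_matrix (Pmat m \<beta>)) (Pmat m \<beta>) n k"
      by (simp add: imat_mult_output_matrix) (simp add: output_matrix_def)
    also have "\<dots> = (\<Sum>j\<le>n. jacobi_rogers m \<beta> n j * Pmat m \<beta> j k)"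
      by (subst imat_mult_eq_sum[of "{..n}"]) (simp_all add: jacobi_rogers_eq_0 flip: Suc)
    finally show ?case by (simp add: jacobi_rogers_Suc)
  qed
qed

lemma (in comm_ring_hom) output_matrix_Pmat_binomial_mat:
  "imat_mult (output_matrix (hom_mat (Pmat m \<beta>))) (binomial_mat q) n 0 =
    (\<Sum>k\<le>n. hom (jacobi_rogers m \<beta> n k) * q ^ k)"
proof -
  have "output_matrix (hom_mat (Pmat m \<beta>)) = hom_mat (jacobi_rogers m \<beta>)"
    by (simp add: output_matrix_def jacobi_rogers_eq_output_matrix row_finite_Pmat
        flip: hom_mat_pow)
  then show ?thesis
    by (subst imat_mult_eq_sum[of "{..n}"]) (simp_all add: jacobi_rogers_eq_0 binomial_mat_def)
qed

section \<open>Polynomials with nonnegative coefficients\<close>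

lemma (in subsemiring) subsemiring_poly: "subsemiring {p. \<forall>d. coeff p d \<in> N}"
proof
  fix p r :: "'a poly" assume "p \<in> {p. \<forall>d. coeff p d \<in> N}" "r \<in> {p. \<forall>d. coeff p d \<in> N}"
  then show "p + r \<in> {p. \<forall>d. coeff p d \<in> N}" "p * r \<in> {p. \<forall>d. coeff p d \<in> N}"
    by (auto simp: coeff_mult intro!: add_mem sum_mem mult_mem)
qed (auto simp: zero_mem one_mem coeff_pCons split: nat.splits)

lemma mpoly_eq_sum_single:
  "p = (\<Sum>e\<in>Poly_Mapping.keys p. Poly_Mapping.single e (Poly_Mapping.lookup p e))"
proof (rule poly_mapping_eqI)
  fix e
  have "(\<Sum>e'\<in>Poly_Mapping.keys p.
        Poly_Mapping.lookup (Poly_Mapping.single e' (Poly_Mapping.lookup p e')) e) =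
      (\<Sum>e'\<in>Poly_Mapping.keys p. if e' = e then Poly_Mapping.lookup p e else 0)"
    by (intro sum.cong refl) (auto simp: lookup_single when_def)
  then show "Poly_Mapping.lookup p e = Poly_Mapping.lookup
      (\<Sum>e\<in>Poly_Mapping.keys p. Poly_Mapping.single e (Poly_Mapping.lookup p e)) e"
    by (simp add: lookup_sum in_keys_iff)
qed

lemma mpoly_mult_eq_sum_single:
  "p * r = (\<Sum>e\<in>Poly_Mapping.keys p. \<Sum>e'\<in>Poly_Mapping.keys r.
     Poly_Mapping.single (e + e') (Poly_Mapping.lookup p e * Poly_Mapping.lookup r e'))"
  by (subst mpoly_eq_sum_single[of p], subst mpoly_eq_sum_single[of r])
    (simp only: sum_product mult_single)

lemma mcoeff_nonneg_single: "0 \<le> c \<Longrightarrow> mcoeff_nonneg (Poly_Mapping.single e c)"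
  by (simp add: mcoeff_nonneg_def lookup_single when_def)

lemma subsemiring_mcoeff_nonneg: "subsemiring {p. mcoeff_nonneg p}"
proof
  show "1 \<in> {p. mcoeff_nonneg p}"
    using mcoeff_nonneg_single[of 1 0] by simp
  fix p r :: "'v mpoly" assume "p \<in> {p. mcoeff_nonneg p}" "r \<in> {p. mcoeff_nonneg p}"
  then show "p + r \<in> {p. mcoeff_nonneg p}" "p * r \<in> {p. mcoeff_nonneg p}"
    by (auto simp: mcoeff_nonneg_def lookup_add mpoly_mult_eq_sum_single lookup_sum lookup_single
        when_def intro!: sum_nonneg)
qed (simp add: mcoeff_nonneg_def)

lemma comm_ring_hom_mconst: "comm_ring_hom mconst"
  by unfold_locales (simp_all add: mconst_def single_add mult_single)

interpretation const_poly: comm_ring_hom "\<lambda>c :: 'a::comm_ring_1. [:c:]"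
  by unfold_locales simp_all

interpretation nonneg_mpoly_poly:
  nonneg_scalars "{p :: 'v mpoly poly. \<forall>d. mcoeff_nonneg (coeff p d)}" "\<lambda>c. [:mconst c:]"
proof -
  interpret subsemiring "{p :: 'v mpoly poly. \<forall>d. mcoeff_nonneg (coeff p d)}"
    using subsemiring.subsemiring_poly[OF subsemiring_mcoeff_nonneg] by simp
  interpret comm_ring_hom "mconst :: real \<Rightarrow> 'v mpoly" by (rule comm_ring_hom_mconst)
  have "mcoeff_nonneg (coeff [:mconst c :: 'v mpoly:] d)" if "0 \<le> c" for c d
    using mcoeff_nonneg_single[OF that] mcoeff_nonneg_single[of 0 0]
    by (cases d) (simp_all add: mconst_def)
  then show "nonneg_scalars {p :: 'v mpoly poly. \<forall>d. mcoeff_nonneg (coeff p d)} (\<lambda>c. [:mconst c:])"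
    by unfold_locales (simp_all add: hom_add hom_mult)
qed

lemma nonneg_const_poly_iff: "(\<forall>d. mcoeff_nonneg (coeff [:p:] d)) \<longleftrightarrow> mcoeff_nonneg p"
  using mcoeff_nonneg_single[of 0 0] by (auto simp: coeff_pCons split: nat.splits)

section \<open>Coefficientwise Hankel-total positivity\<close>

inductive production_factor :: "'v mpoly imat \<Rightarrow> bool" where
  Lmat: "mcoeff_nonneg a \<Longrightarrow> mcoeff_nonneg b \<Longrightarrow> mcoeff_nonneg c \<Longrightarrow> production_factor (Lmat a b c)"
| Jmat: "mcoeff_nonneg a \<Longrightarrow> mcoeff_nonneg b \<Longrightarrow> mcoeff_nonneg u \<Longrightarrow> mcoeff_nonneg v \<Longrightarrow>
    mcoeff_nonneg lam \<Longrightarrow> production_factor (Jmat a b u v lam)"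
| Gmat: "polya_frequency S f \<Longrightarrow> production_factor (Gmat f)"

lemma production_factor_row_finite: "production_factor M \<Longrightarrow> row_finite M"
  by (cases M rule: production_factor.cases)
    (auto simp: row_finite_Lmat row_finite_Jmat Gmat_def intro: row_finiteI[where b = id])

lemma (in comm_ring_hom) hom_mat_Lmat: "hom_mat (Lmat a b c) = Lmat (hom a) (hom b) (hom c)"
  by (auto simp: Lmat_def fun_eq_iff hom_add hom_mult hom_of_nat hom_numeral)

lemma (in comm_ring_hom) hom_mat_Jmat:
  "hom_mat (Jmat a b u v lam) = Jmat (hom a) (hom b) (hom u) (hom v) (hom lam)"
  by (auto simp: Jmat_def fun_eq_iff hom_add hom_mult hom_of_nat hom_numeral)

lemma const_poly_Gmat:
  "const_poly.hom_mat (Gmat f) = nonneg_mpoly_poly.gamma_mat (Abs_fps (\<lambda>n. [:fps_nth f n:]))"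
  by (auto simp: Gmat_def nonneg_mpoly_poly.gamma_mat_def toeplitz_def fun_eq_iff)

lemma tot_pos_toeplitz_const_poly:
  assumes "polya_frequency S f"
  shows "nonneg_mpoly_poly.tot_pos (toeplitz (Abs_fps (\<lambda>n. [:fps_nth f n:])))"
proof -
  have "toeplitz (Abs_fps (\<lambda>n. [:fps_nth f n:])) = const_poly.hom_mat (toeplitz f)"
    by (auto simp: toeplitz_def fun_eq_iff)
  then show ?thesis
    using assms
    by (simp add: nonneg_mpoly_poly.tot_pos_def const_poly.imat_minor_hom polya_frequency_def
        nonneg_const_poly_iff)
qed

lemma production_factor_binomial_positive:
  assumes "production_factor M"
  shows "nonneg_mpoly_poly.binomial_positive [:0, 1:] (const_poly.hom_mat M)"
proof -
  have X: "[:0, 1:] \<in> {p :: 'v mpoly poly. \<forall>d. mcoeff_nonneg (coeff p d)}"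
    using mcoeff_nonneg_single[of 0 0] mcoeff_nonneg_single[of 1 0]
    by (auto simp: coeff_pCons split: nat.splits)
  show ?thesis
    using assms
  proof cases
    case Lmat
    then show ?thesis unfolding Lmat const_poly.hom_mat_Lmat
      by (intro nonneg_mpoly_poly.binomial_positive_Lmat X) (auto simp: nonneg_const_poly_iff)
  next
    case Jmat
    then show ?thesis unfolding Jmat const_poly.hom_mat_Jmat
      by (intro nonneg_mpoly_poly.binomial_positive_Jmat X) (auto simp: nonneg_const_poly_iff)
  next
    case Gmat
    then show ?thesis unfolding Gmat const_poly_Gmat
      by (intro nonneg_mpoly_poly.binomial_positive_gamma_mat tot_pos_toeplitz_const_poly)
  qed
qed

theorem tot_pos_hankel_jacobi_rogers_row:
  assumes factors: "\<And>M. M \<in> set Ms \<Longrightarrow> production_factor M"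
    and prod: "Pmat m \<beta> = imat_prod Ms"
  shows "nonneg_mpoly_poly.tot_pos (\<lambda>i j. jacobi_rogers_row m \<beta> (i + j))"
proof -
  have "nonneg_mpoly_poly.binomial_positive [:0, 1:] (imat_prod (map const_poly.hom_mat Ms))"
  proof (rule nonneg_mpoly_poly.binomial_positive_prod)
    fix A assume "A \<in> set (map const_poly.hom_mat Ms)"
    then obtain M where "production_factor M" "A = const_poly.hom_mat M"
      using factors by auto
    then show "nonneg_mpoly_poly.binomial_positive [:0, 1:] A"
      by (simp only: production_factor_binomial_positive)
  qed
  then have "nonneg_mpoly_poly.binomial_positive [:0, 1:] (const_poly.hom_mat (Pmat m \<beta>))"
    using factors by (simp add: prod const_poly.hom_mat_prod production_factor_row_finite)
  then show ?thesis
    using nonneg_mpoly_poly.tot_pos_hankel_row_polynomials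
    by (fastforce simp: const_poly.output_matrix_Pmat_binomial_mat jacobi_rogers_row_def
        monom_altdef)
qed

section \<open>Iterates of \<open>Lop\<close> as polynomials in Hankel minors\<close>

definition hankel_minor :: "(nat \<Rightarrow> 'a::comm_ring_1) \<Rightarrow> nat \<Rightarrow> nat \<Rightarrow> 'a" where
  "hankel_minor a k s = imat_minor (\<lambda>i j. a (i + j)) k (\<lambda>i. s + i) id"

lemma hankel_minor_1: "hankel_minor a (Suc 0) s = a s"
  by (simp add: hankel_minor_def imat_minor_expand_row)

lemma hankel_minor_2: "hankel_minor a 2 s = a s * a (s + 2) - (a (s + 1))\<^sup>2"
  by (simp add: hankel_minor_def numeral_eq_Suc imat_minor_expand_row algebra_simps)

lemma hankel_minor_3: "hankel_minor a 3 s =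
    a s * (a (s + 2) * a (s + 4) - (a (s + 3))\<^sup>2) -
    a (s + 1) * (a (s + 1) * a (s + 4) - a (s + 2) * a (s + 3)) +
    a (s + 2) * (a (s + 1) * a (s + 3) - (a (s + 2))\<^sup>2)"
  by (simp add: hankel_minor_def numeral_eq_Suc imat_minor_expand_row algebra_simps)

lemma hankel_minor_4: "hankel_minor a 4 s =
    a s * hankel_minor a 3 (s + 2)
    - a (s + 1) * (a (s + 1) * (a (s + 4) * a (s + 6) - (a (s + 5))\<^sup>2)
        - a (s + 3) * (a (s + 2) * a (s + 6) - a (s + 3) * a (s + 5))
        + a (s + 4) * (a (s + 2) * a (s + 5) - a (s + 3) * a (s + 4)))
    + a (s + 2) * (a (s + 1) * (a (s + 3) * a (s + 6) - a (s + 4) * a (s + 5))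
        - a (s + 2) * (a (s + 2) * a (s + 6) - a (s + 3) * a (s + 5))
        + a (s + 4) * (a (s + 2) * a (s + 4) - (a (s + 3))\<^sup>2))
    - a (s + 3) * (a (s + 1) * (a (s + 3) * a (s + 5) - (a (s + 4))\<^sup>2)
        - a (s + 2) * (a (s + 2) * a (s + 5) - a (s + 3) * a (s + 4))
        + a (s + 3) * (a (s + 2) * a (s + 4) - (a (s + 3))\<^sup>2))"
  unfolding hankel_minor_3
  by (simp add: hankel_minor_def numeral_eq_Suc imat_minor_expand_row algebra_simps)

text \<open>The next two identities are instances of the Desnanot--Jacobi identity.\<close>

lemma hankel_minor_2_condensation:
  "hankel_minor a 2 s * hankel_minor a 2 (s + 2) - (hankel_minor a 2 (s + 1))\<^sup>2 =
    a (s + 2) * hankel_minor a 3 s"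
  unfolding hankel_minor_2 hankel_minor_3
  by (simp add: numeral_eq_Suc algebra_simps)

lemma hankel_minor_3_condensation:
  "hankel_minor a 3 s * hankel_minor a 3 (s + 2) - (hankel_minor a 3 (s + 1))\<^sup>2 =
    hankel_minor a 2 (s + 2) * hankel_minor a 4 s"
proof -
  have shift: "s + 2 + 1 = s + 3" "s + 2 + 2 = s + 4" "s + 2 + 3 = s + 5" "s + 2 + 4 = s + 6"
    "s + 1 + 1 = s + 2" "s + 1 + 2 = s + 3" "s + 1 + 3 = s + 4" "s + 1 + 4 = s + 5"
    by simp_all
  show ?thesis
    unfolding hankel_minor_2 hankel_minor_3 hankel_minor_4 shift power2_eq_square
    by (simp only: algebra_simps)
qed

lemma Lop_add_1: "Lop a (s + 1) = a s * a (s + 2) - (a (s + 1))\<^sup>2"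
  by (simp add: Lop_def)

lemma Lop_eq_hankel_minor: "Lop a (s + 1) = hankel_minor a 2 s"
  by (simp only: Lop_add_1 hankel_minor_2)

lemma Lop_Lop_eq_hankel_minor: "Lop (Lop a) (s + 2) = a (s + 2) * hankel_minor a 3 s"
proof -
  have "Lop (Lop a) (s + 2) = Lop a (s + 1) * Lop a (s + 2 + 1) - (Lop a (s + 1 + 1))\<^sup>2"
    using Lop_add_1[of "Lop a" "s + 1"] by (simp add: numeral_eq_Suc)
  then show ?thesis
    unfolding Lop_eq_hankel_minor hankel_minor_2_condensation .
qed

lemma Lop_Lop_Lop_eq_hankel_minor:
  "Lop (Lop (Lop a)) (s + 3) = hankel_minor a 2 (s + 2) *
    (hankel_minor a 3 s * hankel_minor a 3 (s + 2) + (a (s + 3))\<^sup>2 * hankel_minor a 4 s)"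
proof -
  let ?h = "hankel_minor a 3"
  have "Lop (Lop (Lop a)) (s + 3) =
      Lop (Lop a) (s + 2) * Lop (Lop a) (s + 2 + 2) - (Lop (Lop a) (s + 1 + 2))\<^sup>2"
    using Lop_add_1[of "Lop (Lop a)" "s + 2"] by (simp add: numeral_eq_Suc)
  also have "\<dots> = a (s + 2) * a (s + 4) * (?h s * ?h (s + 2)) - (a (s + 3) * ?h (s + 1))\<^sup>2"
    unfolding Lop_Lop_eq_hankel_minor by (simp add: numeral_eq_Suc mult_ac)
  also have "\<dots> = (a (s + 2) * a (s + 4) - (a (s + 3))\<^sup>2) * (?h s * ?h (s + 2)) +
      (a (s + 3))\<^sup>2 * (?h s * ?h (s + 2) - (?h (s + 1))\<^sup>2)"
    by (simp add: algebra_simps power2_eq_square)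
  also have "a (s + 2) * a (s + 4) - (a (s + 3))\<^sup>2 = hankel_minor a 2 (s + 2)"
    unfolding hankel_minor_2 by (simp add: numeral_eq_Suc)
  finally show ?thesis
    unfolding hankel_minor_3_condensation by (simp add: algebra_simps)
qed

context subsemiring
begin

lemma hankel_minor_mem: "tot_pos (\<lambda>i j. a (i + j)) \<Longrightarrow> hankel_minor a k s \<in> N"
  unfolding hankel_minor_def by (erule tot_posD) (auto intro!: strict_mono_onI)

theorem Lop_funpow_mem:
  assumes "tot_pos (\<lambda>i j. a (i + j))" "k \<le> 3" "k \<le> i"
  shows "(Lop ^^ k) a i \<in> N"
proof -
  note minor = hankel_minor_mem[OF assms(1)]
  have a: "a s \<in> N" for s
    using minor[of "Suc 0" s] by (simp only: hankel_minor_1)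
  obtain s where s: "i = s + k" using assms(3) le_Suc_ex by (metis add.commute)
  consider "k = 0" | "k = 1" | "k = 2" | "k = 3" using assms(2) by linarith
  then show ?thesis
  proof cases
    case 1
    then show ?thesis using a by simp
  next
    case 2
    then have "(Lop ^^ k) a i = Lop a (s + 1)" using s by simp
    then show ?thesis unfolding Lop_eq_hankel_minor using minor by simp
  next
    case 3
    then have "(Lop ^^ k) a i = Lop (Lop a) (s + 2)" using s by (simp add: numeral_eq_Suc)
    then show ?thesis unfolding Lop_Lop_eq_hankel_minor using a minor by (simp add: mult_mem)
  next
    case 4
    then have "(Lop ^^ k) a i = Lop (Lop (Lop a)) (s + 3)" using s by (simp add: numeral_eq_Suc)
    then show ?thesis
      unfolding Lop_Lop_Lop_eq_hankel_minor power2_eq_square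
      by (simp only: add_mem mult_mem a minor)
  qed
qed

end

section \<open>Quadratic forms with nonnegative principal minors\<close>

definition quadratic_form :: "'a::comm_ring_1 imat \<Rightarrow> nat \<Rightarrow> (nat \<Rightarrow> 'a) \<Rightarrow> 'a" where
  "quadratic_form A n x = (\<Sum>i<n. \<Sum>j<n. x i * x j * A i j)"

definition schur_complement :: "'a::field imat \<Rightarrow> 'a imat" where
  "schur_complement A = (\<lambda>i j. A (Suc i) (Suc j) - A (Suc i) 0 * A 0 (Suc j) / A 0 0)"

lemma imat_minor_subtract_first_row:
  "imat_minor (\<lambda>i j. if i = 0 then A 0 j else A i j - x i * A 0 j) (Suc k) id id =
    imat_minor A (Suc k) id id"
proof -
  define T where "T = (\<lambda>i j. if i = 0 then A 0 j else A i j - x i * A 0 j)"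
  define E where "E = (\<lambda>i j. if i = j then 1 else if j = 0 then x i else 0)"
  let ?M = "\<lambda>A. Matrix.mat (Suc k) (Suc k) (\<lambda>(i, j). A (id i) (id j))"
  have "?M A = ?M E * ?M T"
  proof (rule eq_matI)
    fix i j assume "i < dim_row (?M E * ?M T)" "j < dim_col (?M E * ?M T)"
    then have ij: "i < Suc k" "j < Suc k" by auto
    then have "(?M E * ?M T) $$ (i, j) = (\<Sum>l<Suc k. E i l * T l j)"
      by (simp add: scalar_prod_def atLeast0LessThan del: sum.lessThan_Suc)
    also have "\<dots> = (\<Sum>l\<in>{0, i}. E i l * T l j)"
      using ij by (intro sum.mono_neutral_right) (auto simp: E_def)
    also have "\<dots> = A i j" by (cases "i = 0") (auto simp: E_def T_def)
    finally show "?M A $$ (i, j) = (?M E * ?M T) $$ (i, j)" using ij by simp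
  qed auto
  moreover have "Determinant.det (?M E) = 1"
  proof -
    have "Determinant.det (?M E) = prod_list (diag_mat (?M E))"
      by (rule det_lower_triangular[of "Suc k"]) (auto simp: E_def)
    then show ?thesis by (simp add: prod_list_diag_prod E_def)
  qed
  ultimately have "imat_minor A (Suc k) id id = imat_minor T (Suc k) id id"
    unfolding imat_minor_def by (simp add: det_mult[of _ "Suc k"])
  then show ?thesis by (simp add: T_def)
qed

lemma imat_minor_schur_complement:
  assumes a: "A 0 0 \<noteq> 0" and r: "r 0 = 0" "\<And>i. r (Suc i) = Suc (r' i)"
    and c: "c 0 = 0" "\<And>i. c (Suc i) = Suc (c' i)"
  shows "imat_minor A (Suc k) r c = A 0 0 * imat_minor (schur_complement A) k r' c'"
proof -
  define T where "T = (\<lambda>i j. if i = 0 then A (r 0) (c j)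
    else A (r i) (c j) - A (r i) 0 / A 0 0 * A (r 0) (c j))"
  have "imat_minor A (Suc k) r c = imat_minor (\<lambda>i j. A (r i) (c j)) (Suc k) id id"
    by (rule imat_minor_cong) simp
  also have "\<dots> = imat_minor T (Suc k) id id"
    using imat_minor_subtract_first_row[of "\<lambda>i j. A (r i) (c j)" "\<lambda>i. A (r i) 0 / A 0 0" k]
    by (simp add: T_def)
  also have "\<dots> = imat_minor (\<lambda>j i. T i j) (Suc k) id id"
    by (rule imat_minor_transpose[symmetric])
  also have "\<dots> = T 0 0 * imat_minor (\<lambda>j i. T i j) k Suc Suc"
    using a r(1) c(1) by (subst imat_minor_expand_row_single) (auto simp: T_def)
  also have "imat_minor (\<lambda>j i. T i j) k Suc Suc = imat_minor T k Suc Suc"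
    by (rule imat_minor_transpose)
  also have "\<dots> = imat_minor (schur_complement A) k r' c'"
    by (rule imat_minor_cong) (simp add: T_def schur_complement_def r c)
  finally show ?thesis by (simp add: T_def r c)
qed

definition principal_minors_nonneg :: "real imat \<Rightarrow> bool" where
  "principal_minors_nonneg A \<longleftrightarrow> (\<forall>k r. strict_mono_on {..<k} r \<longrightarrow> 0 \<le> imat_minor A k r r)"

lemma principal_minors_nonneg_shift:
  assumes "principal_minors_nonneg A"
  shows "principal_minors_nonneg (\<lambda>i j. A (Suc i) (Suc j))"
  unfolding principal_minors_nonneg_def
proof (intro allI impI)
  fix k and r :: "nat \<Rightarrow> nat" assume "strict_mono_on {..<k} r"
  then have "strict_mono_on {..<k} (\<lambda>i. Suc (r i))" by (simp add: strict_mono_on_def)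
  then have "0 \<le> imat_minor A k (\<lambda>i. Suc (r i)) (\<lambda>i. Suc (r i))"
    using assms by (simp add: principal_minors_nonneg_def)
  then show "0 \<le> imat_minor (\<lambda>i j. A (Suc i) (Suc j)) k r r" by (simp add: imat_minor_def)
qed

lemma principal_minors_nonneg_schur_complement:
  assumes "principal_minors_nonneg A" and "0 < A 0 0"
  shows "principal_minors_nonneg (schur_complement A)"
  unfolding principal_minors_nonneg_def
proof (intro allI impI)
  fix k and r :: "nat \<Rightarrow> nat" assume r: "strict_mono_on {..<k} r"
  define r' where "r' i = (case i of 0 \<Rightarrow> 0 | Suc i \<Rightarrow> Suc (r i))" for i
  have "strict_mono_on {..<Suc k} r'"
    using r by (auto simp: strict_mono_on_def r'_def split: nat.splits)
  then have "0 \<le> imat_minor A (Suc k) r' r'"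
    using assms(1) by (simp add: principal_minors_nonneg_def)
  also have "\<dots> = A 0 0 * imat_minor (schur_complement A) k r r"
    using assms(2) by (intro imat_minor_schur_complement) (simp_all add: r'_def)
  finally show "0 \<le> imat_minor (schur_complement A) k r r"
    using assms(2) by (simp add: zero_le_mult_iff)
qed

lemma principal_minors_nonneg_zero_pivot:
  assumes "principal_minors_nonneg A" and sym: "\<And>i j. A i j = A j i" and "A 0 0 = 0"
  shows "A 0 j = 0"
proof (cases j)
  case (Suc j')
  let ?r = "\<lambda>i::nat. if i = 0 then 0 else Suc j'"
  have "strict_mono_on {..<Suc (Suc 0)} ?r" by (auto simp: strict_mono_on_def)
  then have "0 \<le> imat_minor A (Suc (Suc 0)) ?r ?r"
    using assms(1) unfolding principal_minors_nonneg_def by blast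
  then have "(A 0 j)\<^sup>2 \<le> 0"
    using assms(3) sym[of j 0] by (simp add: imat_minor_expand_row Suc power2_eq_square)
  then show ?thesis by simp
qed (simp add: assms(3))

lemma quadratic_form_Suc:
  assumes sym: "\<And>i j. A i j = A j i"
  shows "quadratic_form A (Suc n) x = A 0 0 * (x 0)\<^sup>2 + 2 * x 0 * (\<Sum>j<n. x (Suc j) * A 0 (Suc j)) +
    quadratic_form (\<lambda>i j. A (Suc i) (Suc j)) n (\<lambda>i. x (Suc i))"
  unfolding quadratic_form_def sum.lessThan_Suc_shift using sym[of "Suc _" 0]
  by (simp add: sum.distrib sum_distrib_left mult_ac power2_eq_square)

lemma quadratic_form_schur_complement:
  fixes A :: "'a::field imat"
  assumes sym: "\<And>i j. A i j = A j i" and a: "A 0 0 \<noteq> 0"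
  shows "quadratic_form A (Suc n) x =
    A 0 0 * (x 0 + (\<Sum>j<n. x (Suc j) * A 0 (Suc j)) / A 0 0)\<^sup>2 +
    quadratic_form (schur_complement A) n (\<lambda>i. x (Suc i))"
proof -
  define y where "y = (\<Sum>j<n. x (Suc j) * A 0 (Suc j))"
  have "quadratic_form (schur_complement A) n (\<lambda>i. x (Suc i)) =
      quadratic_form (\<lambda>i j. A (Suc i) (Suc j)) n (\<lambda>i. x (Suc i)) - y\<^sup>2 / A 0 0"
    unfolding y_def power2_eq_square sum_product sum_divide_distrib quadratic_form_def
    using sym[of "Suc _" 0]
    by (simp add: schur_complement_def right_diff_distrib sum_subtractf mult_ac)
  moreover have "A 0 0 * (x 0 + y / A 0 0)\<^sup>2 = A 0 0 * (x 0)\<^sup>2 + 2 * x 0 * y + y\<^sup>2 / A 0 0"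
    using a by (simp add: power2_eq_square field_simps)
  ultimately show ?thesis
    unfolding quadratic_form_Suc[of A, OF sym] y_def[symmetric] by simp
qed

theorem quadratic_form_nonneg:
  assumes "\<And>i j. A i j = A j i" and "principal_minors_nonneg A"
  shows "0 \<le> quadratic_form A n x"
  using assms
proof (induction n arbitrary: A x)
  case 0
  show ?case by (simp add: quadratic_form_def)
next
  case (Suc n)
  note sym = Suc.prems(1) and minors = Suc.prems(2)
  have "strict_mono_on {..<Suc 0} (id :: nat \<Rightarrow> nat)" by (auto simp: strict_mono_on_def)
  then have "0 \<le> imat_minor A (Suc 0) id id"
    using minors unfolding principal_minors_nonneg_def by blast
  then have "0 \<le> A 0 0" by (simp add: imat_minor_expand_row)
  then consider "A 0 0 = 0" | "0 < A 0 0" by linarith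
  then show ?case
  proof cases
    case 1
    have "0 \<le> quadratic_form (\<lambda>i j. A (Suc i) (Suc j)) n (\<lambda>i. x (Suc i))"
      by (rule Suc.IH) (use sym principal_minors_nonneg_shift[OF minors] in auto)
    then show ?thesis
      using principal_minors_nonneg_zero_pivot[of A, OF minors sym 1]
      by (simp add: quadratic_form_Suc[of A, OF sym])
  next
    case 2
    have "0 \<le> quadratic_form (schur_complement A) n (\<lambda>i. x (Suc i))"
    proof (rule Suc.IH)
      show "schur_complement A i j = schur_complement A j i" for i j
        using sym[of "Suc i" "Suc j"] sym[of "Suc i" 0] sym[of 0 "Suc j"]
        by (simp add: schur_complement_def)
      show "principal_minors_nonneg (schur_complement A)"
        using minors 2 by (rule principal_minors_nonneg_schur_complement)
    qed
    then show ?thesis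
      using 2 by (subst quadratic_form_schur_complement[of A, OF sym]) simp_all
  qed
qed

section \<open>Polynomials that are nonnegative on the half line\<close>

definition halfline_sos :: "real poly set" where
  "halfline_sos = {r * r + [:0, 1:] * (s * s) |r s. True}"

lemma halfline_sosI: "p = r * r + [:0, 1:] * (s * s) \<Longrightarrow> p \<in> halfline_sos"
  by (auto simp: halfline_sos_def)

lemma poly_halfline_sos_nonneg: "p \<in> halfline_sos \<Longrightarrow> 0 \<le> x \<Longrightarrow> 0 \<le> poly p x"
  by (auto simp: halfline_sos_def)

lemma two_square_identity:
  fixes a b c d x :: "'a::comm_ring_1"
  shows "(a * a + x * (b * b)) * (c * c + x * (d * d)) =
    (a * c + x * (b * d)) * (a * c + x * (b * d)) + x * ((a * d - b * c) * (a * d - b * c))"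
  by (simp add: algebra_simps)

lemma halfline_sos_mult: "p \<in> halfline_sos \<Longrightarrow> r \<in> halfline_sos \<Longrightarrow> p * r \<in> halfline_sos"
  unfolding halfline_sos_def using two_square_identity[of _ "[:0, 1:]"] by blast

lemma const_mem_halfline_sos: "0 \<le> c \<Longrightarrow> [:c:] \<in> halfline_sos"
  by (rule halfline_sosI[of _ "[:sqrt c:]" 0]) simp

lemma linear_mem_halfline_sos: "c \<le> 0 \<Longrightarrow> [:- c, 1:] \<in> halfline_sos"
  by (rule halfline_sosI[of _ "[:sqrt (- c):]" 1]) simp

lemma quadratic_mem_halfline_sos: "[:(cmod z)\<^sup>2, - 2 * Re z, 1:] \<in> halfline_sos"
proof (rule halfline_sosI)
  have "sqrt (2 * (cmod z - Re z)) * sqrt (2 * (cmod z - Re z)) = 2 * (cmod z - Re z)"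
    using complex_Re_le_cmod[of z] by simp
  then show "[:(cmod z)\<^sup>2, - 2 * Re z, 1:] = [:- cmod z, 1:] * [:- cmod z, 1:] +
      [:0, 1:] * ([:sqrt (2 * (cmod z - Re z)):] * [:sqrt (2 * (cmod z - Re z)):])"
    by (simp add: power2_eq_square)
qed

lemma poly_nonneg_cancel_left:
  fixes w s :: "real poly"
  assumes "w \<noteq> 0" and w: "\<And>x. c \<le> x \<Longrightarrow> 0 \<le> poly w x"
    and ws: "\<And>x. c \<le> x \<Longrightarrow> 0 \<le> poly (w * s) x" and "c \<le> x"
  shows "0 \<le> poly s x"
proof (rule tendsto_lowerbound)
  show "(poly s \<longlongrightarrow> poly s x) (at_right x)"
    by (rule tendsto_within_subset[OF isContD]) auto
  have "finite {y. poly w y = 0}" using \<open>w \<noteq> 0\<close> by (rule poly_roots_finite)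
  then have "eventually (\<lambda>y. poly w y \<noteq> 0) (at x)"
    using islimpt_finite islimpt_iff_eventually by fastforce
  then have "eventually (\<lambda>y. poly w y \<noteq> 0) (at_right x)"
    by (rule eventually_at_split[THEN iffD1, THEN conjunct2])
  moreover have "eventually (\<lambda>y. x < y) (at_right x)"
    by (rule eventually_at_right_less)
  ultimately show "eventually (\<lambda>y. 0 \<le> poly s y) (at_right x)"
  proof eventually_elim
    case (elim y)
    then show ?case using w[of y] ws[of y] \<open>c \<le> x\<close> by (simp add: zero_le_mult_iff)
  qed
qed simp

lemma nonreal_root_quadratic_dvd:
  assumes z: "poly (map_poly complex_of_real p) z = 0" and "Im z \<noteq> 0"
  shows "[:(cmod z)\<^sup>2, - 2 * Re z, 1:] dvd p"
proof -
  interpret map_poly_comm_ring_hom complex_of_real by unfold_locales auto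
  define w where "w = [:(cmod z)\<^sup>2, - 2 * Re z, 1:]"
  define r where "r = p mod w"
  have "map_poly complex_of_real p =
      map_poly complex_of_real (p div w) * map_poly complex_of_real w + map_poly complex_of_real r"
    unfolding hom_mult[symmetric] hom_add[symmetric] by (simp add: r_def)
  moreover have "poly (map_poly complex_of_real w) z = 0"
    unfolding w_def cmod_power2
    by (simp add: Polynomial.map_poly_pCons complex_eq_iff power2_eq_square algebra_simps)
  ultimately have rz: "poly (map_poly complex_of_real r) z = 0" using z by simp
  have "degree r < 2 \<or> r = 0"
    using degree_mod_less[of w p] unfolding r_def by (auto simp: w_def)
  then have "r = [:coeff r 0, coeff r 1:]"
    by (intro poly_eqI) (auto simp: coeff_pCons coeff_eq_0 split: nat.splits)
  then obtain \<alpha> \<beta> where r: "r = [:\<alpha>, \<beta>:]" by blast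
  have "poly (map_poly complex_of_real r) z = complex_of_real \<alpha> + z * complex_of_real \<beta>"
    by (simp add: r Polynomial.map_poly_pCons)
  then have "complex_of_real \<alpha> + z * complex_of_real \<beta> = 0" using rz by (rule trans[OF sym])
  then have "\<beta> = 0" "\<alpha> = 0" using \<open>Im z \<noteq> 0\<close> by (auto simp: complex_eq_iff)
  then show ?thesis using r by (simp add: r_def w_def mod_eq_0_iff_dvd)
qed

lemma poly_local_min_root_dvd:
  fixes p :: "real poly"
  assumes "poly p c = 0" and "0 < \<delta>" and min: "\<And>x. \<bar>c - x\<bar> < \<delta> \<Longrightarrow> 0 \<le> poly p x"
  shows "[:- c, 1:] * [:- c, 1:] dvd p"
proof -
  obtain r where r: "p = [:- c, 1:] * r" using assms(1) by (auto simp: poly_eq_0_iff_dvd)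
  have "poly (pderiv p) c = 0"
    using poly_DERIV[of p c] \<open>0 < \<delta>\<close> by (rule DERIV_local_min) (use assms(1) min in auto)
  moreover have "poly (pderiv p) c = poly r c"
    unfolding r pderiv_mult by (simp add: pderiv_pCons)
  ultimately have "poly r c = 0" by simp
  then have "[:- c, 1:] dvd r" by (simp add: poly_eq_0_iff_dvd)
  then show ?thesis unfolding r by (intro mult_dvd_mono) simp_all
qed

lemma nonneg_poly_halfline_factor:
  assumes "0 < degree p" and nonneg: "\<And>x. 0 \<le> x \<Longrightarrow> 0 \<le> poly p x"
  obtains w where "w \<in> halfline_sos" "0 < degree w" "w dvd p"
proof -
  have "degree (map_poly complex_of_real p) = degree p" by (rule degree_map_poly) auto
  then have "\<not> constant (poly (map_poly complex_of_real p))"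
    using assms(1) by (simp add: constant_degree)
  then obtain z where z: "poly (map_poly complex_of_real p) z = 0"
    using fundamental_theorem_of_algebra by blast
  show thesis
  proof (cases "Im z = 0")
    case False
    then show thesis
      using that[OF quadratic_mem_halfline_sos _ nonreal_root_quadratic_dvd[OF z]] by simp
  next
    case True
    then obtain c where c: "z = complex_of_real c" by (metis complex_is_Real_iff Reals_cases)
    interpret of_real_hom: comm_ring_hom complex_of_real by unfold_locales auto
    have root: "poly p c = 0" using z by (simp add: c of_real_hom.poly_map_poly)
    show thesis
    proof (cases "c \<le> 0")
      case True
      then show thesis
        using that[OF linear_mem_halfline_sos] root by (simp add: poly_eq_0_iff_dvd)
    next
      case False
      then have "[:- c, 1:] * [:- c, 1:] dvd p"
        using root nonneg by (intro poly_local_min_root_dvd[of p c c]) auto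
      then show thesis
        by (intro that[OF halfline_sosI[of _ "[:- c, 1:]" 0]]) simp_all
    qed
  qed
qed

theorem nonneg_poly_halfline_sos:
  assumes "\<And>x. 0 \<le> x \<Longrightarrow> 0 \<le> poly p x"
  shows "p \<in> halfline_sos"
  using assms
proof (induction "degree p" arbitrary: p rule: less_induct)
  case less
  show ?case
  proof (cases "degree p = 0")
    case True
    then obtain c where "p = [:c:]" by (metis degree_eq_zeroE)
    then show ?thesis using const_mem_halfline_sos[of c] less.prems[of 0] by simp
  next
    case False
    then have "p \<noteq> 0" by auto
    obtain w where w: "w \<in> halfline_sos" "0 < degree w" "w dvd p"
      using nonneg_poly_halfline_factor[of p] False less.prems by auto
    then obtain s where p: "p = w * s" by auto
    have "0 \<le> poly s x" if "0 \<le> x" for x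
      using \<open>p \<noteq> 0\<close> less.prems poly_halfline_sos_nonneg[OF w(1)] that
      by (intro poly_nonneg_cancel_left[of w 0 s]) (auto simp: p)
    moreover have "degree s < degree p"
      using \<open>p \<noteq> 0\<close> w(2) unfolding p by (subst degree_mult_eq) auto
    ultimately have "s \<in> halfline_sos" by (intro less.hyps)
    then show ?thesis unfolding p by (intro halfline_sos_mult w(1))
  qed
qed

section \<open>Moment functionals\<close>

definition moment_functional :: "(nat \<Rightarrow> real) \<Rightarrow> real poly \<Rightarrow> real" where
  "moment_functional a p = (\<Sum>i\<le>degree p. coeff p i * a i)"

lemma moment_functional_eq_sum:
  "degree p \<le> n \<Longrightarrow> moment_functional a p = (\<Sum>i\<le>n. coeff p i * a i)"
  unfolding moment_functional_def by (intro sum.mono_neutral_left) (auto simp: coeff_eq_0)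

lemma moment_functional_0 [simp]: "moment_functional a 0 = 0"
  by (simp add: moment_functional_def)

lemma moment_functional_add:
  "moment_functional a (p + r) = moment_functional a p + moment_functional a r"
proof -
  let ?n = "max (degree p) (degree r)"
  show ?thesis
    using moment_functional_eq_sum[of "p + r" ?n a] moment_functional_eq_sum[of p ?n a]
      moment_functional_eq_sum[of r ?n a] degree_add_le_max[of p r]
    by (simp add: distrib_right sum.distrib)
qed

lemma moment_functional_smult:
  "moment_functional a (Polynomial.smult c p) = c * moment_functional a p"
  using moment_functional_eq_sum[of "Polynomial.smult c p" "degree p" a] degree_smult_le[of c p]
  by (simp add: moment_functional_def sum_distrib_left mult.assoc)

lemma moment_functional_sum:
  "moment_functional a (\<Sum>i\<in>I. p i) = (\<Sum>i\<in>I. moment_functional a (p i))"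
  by (induction I rule: infinite_finite_induct) (simp_all add: moment_functional_add)

lemma moment_functional_monom: "moment_functional a (Polynomial.monom c n) = c * a n"
  using moment_functional_eq_sum[of "Polynomial.monom c n" n a] degree_monom_le[of c n]
  by (simp add: if_distrib if_distribR cong: if_cong)

lemma moment_functional_monom_sum_square:
  "moment_functional a (Polynomial.monom 1 e *
      ((\<Sum>i<n. Polynomial.monom (x i) i) * (\<Sum>j<n. Polynomial.monom (x j) j))) =
    quadratic_form (\<lambda>i j. a (i + j + e)) n x"
proof -
  have "(\<Sum>i<n. Polynomial.monom (x i) i) * (\<Sum>j<n. Polynomial.monom (x j) j) =
      (\<Sum>i<n. \<Sum>j<n. Polynomial.monom (x i * x j) (i + j))"
    by (simp only: sum_product mult_monom)
  then show ?thesis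
    by (simp add: quadratic_form_def moment_functional_sum moment_functional_monom
        sum_distrib_left mult_monom add_ac)
qed

lemma moment_functional_monom_square:
  "moment_functional a (Polynomial.monom 1 e * (r * r)) =
    quadratic_form (\<lambda>i j. a (i + j + e)) (Suc (degree r)) (coeff r)"
proof -
  have "(\<Sum>i<Suc (degree r). Polynomial.monom (coeff r i) i) = r"
    using poly_as_sum_of_monoms[of r] by (simp only: lessThan_Suc_atMost)
  then show ?thesis
    using moment_functional_monom_sum_square[of a e "coeff r" "Suc (degree r)"] by simp
qed

definition hankel_psd :: "(nat \<Rightarrow> real) \<Rightarrow> bool" where
  "hankel_psd a \<longleftrightarrow> (\<forall>n x. 0 \<le> quadratic_form (\<lambda>i j. a (i + j)) n x)"

lemma moment_functional_square_nonneg: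
  assumes "hankel_psd a"
  shows "0 \<le> moment_functional a (r * r)"
  using assms moment_functional_monom_square[of a 0 r] by (simp add: hankel_psd_def)

lemma moment_functional_nonneg:
  assumes "hankel_psd a" "hankel_psd (\<lambda>n. a (Suc n))" and "\<And>x. 0 \<le> x \<Longrightarrow> 0 \<le> poly p x"
  shows "0 \<le> moment_functional a p"
proof -
  have "p \<in> halfline_sos" using assms(3) by (rule nonneg_poly_halfline_sos)
  then obtain r s where p: "p = r * r + Polynomial.monom 1 1 * (s * s)"
    by (auto simp: halfline_sos_def monom_Suc monom_0)
  have "0 \<le> moment_functional a (Polynomial.monom 1 1 * (s * s))"
    unfolding moment_functional_monom_square using assms(2) by (simp add: hankel_psd_def)
  then show ?thesis
    using moment_functional_square_nonneg[OF assms(1), of r]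
    unfolding p moment_functional_add by simp
qed

lemma hankel_psd_eq_0:
  assumes "hankel_psd a" "a 0 = 0"
  shows "a n = 0"
proof (rule ccontr)
  assume "a n \<noteq> 0"
  define t where "t = (- 1 - a (2 * n)) / (2 * a n)"
  let ?r = "Polynomial.monom 1 n + Polynomial.monom t 0"
  have "?r * ?r = Polynomial.monom 1 (n + n) + Polynomial.monom t n +
      (Polynomial.monom t n + Polynomial.monom (t * t) 0)"
    by (simp only: distrib_left distrib_right mult_monom mult_1_left mult_1_right
        add_0_left add_0_right)
  then have "0 \<le> a (2 * n) + 2 * t * a n"
    using moment_functional_square_nonneg[OF assms(1), of ?r] assms(2)
    by (simp only: moment_functional_add moment_functional_monom mult_2) simp
  moreover have "2 * t * a n = - 1 - a (2 * n)" using \<open>a n \<noteq> 0\<close> by (simp add: t_def)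
  ultimately show False by linarith
qed

section \<open>Approximation by moments of atomic measures\<close>

definition atomic_moments :: "(nat \<Rightarrow> real) set" where
  "atomic_moments = {(\<lambda>i. \<Sum>x\<in>S. w x * x ^ i) |S w. finite S \<and> (\<forall>x\<in>S. 0 \<le> x \<and> 0 \<le> w x)}"

lemma atomic_moments_zero: "(\<lambda>i. 0) \<in> atomic_moments"
  unfolding atomic_moments_def by (intro CollectI exI[of _ "{}"]) simp

lemma atomic_moments_scale:
  assumes "m \<in> atomic_moments" "0 \<le> t"
  shows "(\<lambda>i. t * m i) \<in> atomic_moments"
proof -
  obtain S w where "finite S" "\<forall>x\<in>S. 0 \<le> x \<and> 0 \<le> w x" "m = (\<lambda>i. \<Sum>x\<in>S. w x * x ^ i)"
    using assms(1) by (auto simp: atomic_moments_def)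
  then show ?thesis unfolding atomic_moments_def using assms(2)
    by (intro CollectI exI[of _ S] exI[of _ "\<lambda>x. t * w x"]) (auto simp: sum_distrib_left mult.assoc)
qed

lemma atomic_moments_add_atom:
  assumes "m \<in> atomic_moments" "0 \<le> t" "0 \<le> y"
  shows "(\<lambda>i. m i + t * y ^ i) \<in> atomic_moments"
proof -
  obtain S w where S: "finite S" "\<forall>x\<in>S. 0 \<le> x \<and> 0 \<le> w x" and m: "m = (\<lambda>i. \<Sum>x\<in>S. w x * x ^ i)"
    using assms(1) by (auto simp: atomic_moments_def)
  define w' where "w' x = (if x \<in> S then w x else 0) + (if x = y then t else 0)" for x
  have "(\<Sum>x\<in>insert y S. w' x * x ^ i) = m i + t * y ^ i" for i
  proof -
    have "(\<Sum>x\<in>insert y S. w' x * x ^ i) = (\<Sum>x\<in>insert y S. (if x \<in> S then w x else 0) * x ^ i) +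
        (\<Sum>x\<in>insert y S. if x = y then t * y ^ i else 0)"
      unfolding sum.distrib[symmetric] w'_def by (intro sum.cong) (auto simp: distrib_right)
    also have "(\<Sum>x\<in>insert y S. (if x \<in> S then w x else 0) * x ^ i) = m i"
      unfolding m using S(1) by (intro sum.mono_neutral_cong_right) auto
    finally show ?thesis using S(1) by simp
  qed
  moreover have "finite (insert y S)" "\<forall>x\<in>insert y S. 0 \<le> x \<and> 0 \<le> w' x"
    using S assms by (auto simp: w'_def)
  ultimately show ?thesis unfolding atomic_moments_def
    by (intro CollectI exI[of _ "insert y S"] exI[of _ w']) simp
qed

lemma near_minimizer_exists:
  fixes f :: "'a \<Rightarrow> real"
  assumes "S \<noteq> {}" "\<And>x. x \<in> S \<Longrightarrow> 0 \<le> f x" "0 < \<delta>"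
  obtains x where "x \<in> S" "\<And>y. y \<in> S \<Longrightarrow> f x \<le> f y + \<delta>"
proof -
  have bdd: "bdd_below (f ` S)" using assms(2) by (rule bdd_belowI2)
  have "Inf (f ` S) < Inf (f ` S) + \<delta>" using assms(3) by simp
  then obtain x where "x \<in> S" "f x < Inf (f ` S) + \<delta>"
    using cInf_lessD[of "f ` S" "Inf (f ` S) + \<delta>"] assms(1) by auto
  moreover have "Inf (f ` S) \<le> f y" if "y \<in> S" for y
    using that bdd by (intro cInf_lower) auto
  ultimately show thesis using that by (smt (verit))
qed

lemma L2_set_power2: "(L2_set f A)\<^sup>2 = (\<Sum>i\<in>A. (f i)\<^sup>2)"
  by (simp add: L2_set_def sum_nonneg)

lemma near_minimizer_variation:
  assumes "0 < \<eta>" "0 < R" and v: "L2_set v A \<le> R"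
    and min: "(L2_set c A)\<^sup>2 \<le> (L2_set (\<lambda>i. c i - \<eta> / R * v i) A)\<^sup>2 + \<eta>\<^sup>2"
  shows "(\<Sum>i\<in>A. c i * v i) \<le> \<eta> * R"
proof -
  let ?t = "\<eta> / R"
  have "(L2_set (\<lambda>i. c i - ?t * v i) A)\<^sup>2 =
      (L2_set c A)\<^sup>2 - 2 * ?t * (\<Sum>i\<in>A. c i * v i) + ?t\<^sup>2 * (L2_set v A)\<^sup>2"
    unfolding L2_set_power2 sum_distrib_left sum_subtractf[symmetric] sum.distrib[symmetric]
    by (intro sum.cong refl) (simp add: power2_eq_square algebra_simps)
  moreover have "?t\<^sup>2 * (L2_set v A)\<^sup>2 \<le> ?t\<^sup>2 * R\<^sup>2"
    using v by (intro mult_left_mono power_mono) (auto simp: L2_set_nonneg)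
  moreover have "?t\<^sup>2 * R\<^sup>2 = \<eta>\<^sup>2" using \<open>0 < R\<close> by (simp add: power_divide)
  ultimately have "?t * (\<Sum>i\<in>A. c i * v i) \<le> \<eta>\<^sup>2" using min by linarith
  then show ?thesis
    using assms(1,2) by (simp add: field_simps power2_eq_square)
qed

definition atomic_near_minimizer :: "(nat \<Rightarrow> real) \<Rightarrow> nat \<Rightarrow> real \<Rightarrow> (nat \<Rightarrow> real) \<Rightarrow> bool" where
  "atomic_near_minimizer a n \<eta> m \<longleftrightarrow> m \<in> atomic_moments \<and> (\<forall>m'\<in>atomic_moments.
     (L2_set (\<lambda>i. a i - m i) {..n})\<^sup>2 \<le> (L2_set (\<lambda>i. a i - m' i) {..n})\<^sup>2 + \<eta>\<^sup>2)"

lemma atomic_near_minimizerD: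
  assumes "atomic_near_minimizer a n \<eta> m" "m' \<in> atomic_moments"
  shows "(L2_set (\<lambda>i. a i - m i) {..n})\<^sup>2 \<le> (L2_set (\<lambda>i. a i - m' i) {..n})\<^sup>2 + \<eta>\<^sup>2"
  using assms by (simp add: atomic_near_minimizer_def)

lemma atomic_near_minimizer_residual_atom:
  assumes m: "atomic_near_minimizer a n \<eta> m" and "0 < \<eta>" "0 \<le> x"
  shows "(\<Sum>i\<le>n. (a i - m i) * x ^ i) \<le> \<eta> * (\<Sum>i\<le>n. x ^ i)"
proof (rule near_minimizer_variation)
  let ?t = "\<eta> / (\<Sum>i\<le>n. x ^ i)"
  have "(\<Sum>i\<in>{0}. x ^ i) \<le> (\<Sum>i\<le>n. x ^ i)" using \<open>0 \<le> x\<close> by (intro sum_mono2) auto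
  then show "0 < (\<Sum>i\<le>n. x ^ i)" by simp
  then have "(\<lambda>i. m i + ?t * x ^ i) \<in> atomic_moments"
    using m \<open>0 < \<eta>\<close> \<open>0 \<le> x\<close>
    by (intro atomic_moments_add_atom) (simp_all add: atomic_near_minimizer_def)
  then show "(L2_set (\<lambda>i. a i - m i) {..n})\<^sup>2 \<le> (L2_set (\<lambda>i. a i - m i - ?t * x ^ i) {..n})\<^sup>2 + \<eta>\<^sup>2"
    unfolding diff_diff_eq by (rule atomic_near_minimizerD[OF m])
  show "L2_set (\<lambda>i. x ^ i) {..n} \<le> (\<Sum>i\<le>n. x ^ i)"
    using \<open>0 \<le> x\<close> by (intro L2_set_le_sum) simp
qed fact

lemma atomic_near_minimizer_residual_self:
  assumes m: "atomic_near_minimizer a n \<eta> m" and "0 < \<eta>" "\<eta> \<le> 1"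
  shows "(\<Sum>i\<le>n. (a i - m i) * - m i) \<le> \<eta> * (1 + L2_set m {..n})"
proof (rule near_minimizer_variation)
  let ?t = "\<eta> / (1 + L2_set m {..n})"
  show R: "0 < 1 + L2_set m {..n}" by (rule add_pos_nonneg) simp_all
  have "\<eta> \<le> 1 + L2_set m {..n}" using \<open>\<eta> \<le> 1\<close> by (rule order_trans) simp
  then have "(\<lambda>i. (1 - ?t) * m i) \<in> atomic_moments"
    using m R by (intro atomic_moments_scale) (simp_all add: atomic_near_minimizer_def)
  moreover have "a i - m i - ?t * - m i = a i - (1 - ?t) * m i" for i
    by (simp add: algebra_simps)
  ultimately show "(L2_set (\<lambda>i. a i - m i) {..n})\<^sup>2 \<le>
      (L2_set (\<lambda>i. a i - m i - ?t * - m i) {..n})\<^sup>2 + \<eta>\<^sup>2"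
    by (simp only: atomic_near_minimizerD[OF m])
qed (simp_all add: \<open>0 < \<eta>\<close> L2_set_def)

text \<open>
  The perturbed residual \<open>\<Sum>\<^sub>i (\<eta> - c\<^sub>i) x\<^sup>i\<close> with \<open>c = a - m\<close> is nonnegative on the half line, so
  that positivity of the moment functional bounds the inner product of \<open>c\<close> and \<open>a\<close> by a multiple of \<open>\<eta>\<close>.
\<close>

lemma atomic_near_minimizer_distance:
  fixes a :: "nat \<Rightarrow> real"
  assumes pos: "\<And>p. (\<And>x. 0 \<le> x \<Longrightarrow> 0 \<le> poly p x) \<Longrightarrow> 0 \<le> moment_functional a p"
    and m: "atomic_near_minimizer a n \<eta> m" and \<eta>: "0 < \<eta>" "\<eta> \<le> 1"
  shows "(L2_set (\<lambda>i. a i - m i) {..n})\<^sup>2 \<le> \<eta> * ((\<Sum>i\<le>n. a i) + 2 * L2_set a {..n} + 2)"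
proof -
  define c where "c i = a i - m i" for i
  define p where "p = (\<Sum>i\<le>n. Polynomial.monom (\<eta> - c i) i)"
  have "poly p x = \<eta> * (\<Sum>i\<le>n. x ^ i) - (\<Sum>i\<le>n. c i * x ^ i)" for x
    by (simp add: p_def poly_sum poly_monom sum_distrib_left sum_subtractf left_diff_distrib)
  then have "0 \<le> moment_functional a p"
    using atomic_near_minimizer_residual_atom[OF m \<eta>(1)] by (intro pos) (simp add: c_def)
  then have c_a: "(\<Sum>i\<le>n. c i * a i) \<le> \<eta> * (\<Sum>i\<le>n. a i)"
    by (simp add: p_def moment_functional_sum moment_functional_monom sum_distrib_left
        sum_subtractf left_diff_distrib)
  have c_m: "(\<Sum>i\<le>n. c i * - m i) \<le> \<eta> * (1 + L2_set m {..n})"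
    using atomic_near_minimizer_residual_self[OF m \<eta>] by (simp only: c_def)
  have "L2_set c {..n} \<le> L2_set a {..n} + 1"
  proof (rule power2_le_imp_le)
    have "\<eta>\<^sup>2 \<le> 1" using \<eta> by (simp add: power_le_one)
    then have "(L2_set c {..n})\<^sup>2 \<le> (L2_set a {..n})\<^sup>2 + 1"
      using atomic_near_minimizerD[OF m atomic_moments_zero] by (simp add: c_def[abs_def])
    then show "(L2_set c {..n})\<^sup>2 \<le> (L2_set a {..n} + 1)\<^sup>2"
      by (simp add: power2_sum add_increasing2)
  qed (simp add: L2_set_nonneg)
  moreover have "L2_set m {..n} \<le> L2_set a {..n} + L2_set (\<lambda>i. - c i) {..n}"
    using L2_set_triangle_ineq[of a "\<lambda>i. - c i" "{..n}"] by (simp add: c_def)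
  moreover have "L2_set (\<lambda>i. - c i) {..n} = L2_set c {..n}" by (simp add: L2_set_def)
  ultimately have "\<eta> * (1 + L2_set m {..n}) \<le> \<eta> * (2 * L2_set a {..n} + 2)"
    using \<eta> by (intro mult_left_mono) auto
  moreover have "(L2_set c {..n})\<^sup>2 = (\<Sum>i\<le>n. c i * a i) + (\<Sum>i\<le>n. c i * - m i)"
    unfolding L2_set_power2 sum.distrib[symmetric]
    by (intro sum.cong refl) (simp add: c_def power2_eq_square algebra_simps)
  ultimately show ?thesis using c_a c_m by (simp add: c_def[abs_def] algebra_simps)
qed

theorem atomic_moments_approx:
  fixes a :: "nat \<Rightarrow> real"
  assumes pos: "\<And>p. (\<And>x. 0 \<le> x \<Longrightarrow> 0 \<le> poly p x) \<Longrightarrow> 0 \<le> moment_functional a p"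
    and "0 < \<epsilon>"
  shows "\<exists>m\<in>atomic_moments. \<forall>i\<le>n. \<bar>a i - m i\<bar> < \<epsilon>"
proof -
  define B where "B = \<bar>(\<Sum>i\<le>n. a i) + 2 * L2_set a {..n} + 2\<bar> + 1"
  define \<eta> where "\<eta> = min 1 (\<epsilon>\<^sup>2 / (2 * B))"
  have B: "0 < B" by (simp add: B_def)
  then have \<eta>: "0 < \<eta>" "\<eta> \<le> 1" using \<open>0 < \<epsilon>\<close> by (auto simp: \<eta>_def)
  obtain m where m: "atomic_near_minimizer a n \<eta> m"
    unfolding atomic_near_minimizer_def
    by (rule near_minimizer_exists[of atomic_moments "\<lambda>m. (L2_set (\<lambda>i. a i - m i) {..n})\<^sup>2" "\<eta>\<^sup>2"])
      (use atomic_moments_zero \<eta> in auto)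
  have "(L2_set (\<lambda>i. a i - m i) {..n})\<^sup>2 \<le> \<eta> * ((\<Sum>i\<le>n. a i) + 2 * L2_set a {..n} + 2)"
    using pos m \<eta> by (rule atomic_near_minimizer_distance)
  also have "\<dots> \<le> \<eta> * B" using \<eta> by (intro mult_left_mono) (auto simp: B_def)
  also have "\<dots> \<le> \<epsilon>\<^sup>2 / (2 * B) * B" using B by (intro mult_right_mono) (auto simp: \<eta>_def)
  also have "\<dots> < \<epsilon>\<^sup>2" using B \<open>0 < \<epsilon>\<close> by simp
  finally have "L2_set (\<lambda>i. a i - m i) {..n} < \<epsilon>"
    using \<open>0 < \<epsilon>\<close> by (simp add: power_less_imp_less_base)
  moreover have "\<bar>a i - m i\<bar> \<le> L2_set (\<lambda>i. a i - m i) {..n}" if "i \<le> n" for i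
    using member_le_L2_set[of "{..n}" i "\<lambda>i. \<bar>a i - m i\<bar>"] that by (simp add: L2_set_def)
  ultimately have "\<forall>i\<le>n. \<bar>a i - m i\<bar> < \<epsilon>" using le_less_trans by blast
  then show ?thesis using m unfolding atomic_near_minimizer_def by blast
qed

section \<open>Moments of distributions on the half line\<close>

definition halfline_distribution :: "real measure \<Rightarrow> (nat \<Rightarrow> real) \<Rightarrow> bool" where
  "halfline_distribution M a \<longleftrightarrow> real_distribution M \<and> (AE x in M. 0 \<le> x) \<and>
     (\<forall>k. integrable M (\<lambda>x. x ^ k) \<and> integral\<^sup>L M (\<lambda>x. x ^ k) = a k)"

lemma stieltjes_moment_halfline_distribution:
  assumes "halfline_distribution M a" "0 \<le> c"
  shows "stieltjes_moment (\<lambda>k. c * a k)"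
proof -
  interpret real_distribution M using assms(1) by (simp add: halfline_distribution_def)
  have nonneg: "AE x in M. 0 \<le> x"
    and int: "integrable M (\<lambda>x. x ^ k)" and a: "integral\<^sup>L M (\<lambda>x. x ^ k) = a k" for k
    using assms(1) by (auto simp: halfline_distribution_def)
  define \<nu> where "\<nu> = density M (\<lambda>_. ennreal c)"
  have AE: "AE x in M. c *\<^sub>R (indicat_real {0..} x *\<^sub>R x ^ k) = c * x ^ k" for k
    using nonneg by eventually_elim simp
  have "set_integrable \<nu> {0..} (\<lambda>x. x ^ k)" for k
  proof -
    have "integrable M (\<lambda>x. c *\<^sub>R (indicat_real {0..} x *\<^sub>R x ^ k))"
      using int[of k] by (subst integrable_cong_AE[OF _ _ AE]) auto
    then show ?thesis
      unfolding set_integrable_def \<nu>_def using \<open>0 \<le> c\<close> by (subst integrable_density) auto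
  qed
  moreover have "(LINT x:{0..}|\<nu>. x ^ k) = c * a k" for k
  proof -
    have "(LINT x:{0..}|\<nu>. x ^ k) = (LINT x|M. c *\<^sub>R (indicat_real {0..} x *\<^sub>R x ^ k))"
      unfolding set_lebesgue_integral_def \<nu>_def using \<open>0 \<le> c\<close> by (subst integral_density) auto
    also have "\<dots> = (LINT x|M. c * x ^ k)"
      by (rule integral_cong_AE[OF _ _ AE]) auto
    finally show ?thesis by (simp add: a)
  qed
  moreover have "sets \<nu> = sets borel" by (simp add: \<nu>_def)
  ultimately show ?thesis unfolding stieltjes_moment_def by (intro exI[of _ \<nu>]) simp
qed

lemma prob_space_density_real:
  fixes g :: "'a \<Rightarrow> real"
  assumes "integrable M g" "\<And>x. 0 \<le> g x" "integral\<^sup>L M g = 1"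
  shows "prob_space (density M (\<lambda>x. ennreal (g x)))"
proof
  let ?D = "density M (\<lambda>x. ennreal (g x))"
  have "emeasure ?D (space M) = (\<integral>\<^sup>+x. ennreal (g x) * indicator (space M) x \<partial>M)"
    using assms(1) by (simp add: emeasure_density)
  also have "\<dots> = (\<integral>\<^sup>+x. ennreal (g x) \<partial>M)" by (rule nn_integral_cong) simp
  also have "\<dots> = 1" using assms by (simp add: nn_integral_eq_integral)
  finally show "emeasure ?D (space ?D) = 1" by simp
qed

lemma stieltjes_moment_imp_halfline_distribution:
  assumes "stieltjes_moment a" "0 < a 0"
  obtains M where "halfline_distribution M (\<lambda>k. a k / a 0)"
proof -
  obtain \<mu> :: "real measure" where sets: "sets \<mu> = sets borel"
    and int: "\<And>k. integrable \<mu> (\<lambda>x. indicator {0..} x *\<^sub>R x ^ k)"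
    and a: "\<And>k. a k = (LINT x|\<mu>. indicator {0..} x *\<^sub>R x ^ k)"
    using assms(1)
    by (auto simp: stieltjes_moment_def set_integrable_def set_lebesgue_integral_def)
  define g where "g = (\<lambda>x :: real. indicator {0..} x / a 0)"
  have "g \<in> borel_measurable borel" unfolding g_def by measurable
  then have g: "g \<in> borel_measurable \<mu>" "\<And>x. 0 \<le> g x"
    using assms(2) by (simp_all add: g_def measurable_cong_sets[OF sets refl])
  have g_power: "g x *\<^sub>R x ^ k = (indicator {0..} x *\<^sub>R x ^ k) / a 0" for x k
    by (simp add: g_def)
  have power: "(\<lambda>x. x ^ k) \<in> borel_measurable \<mu>" for k
    by (simp add: measurable_cong_sets[OF sets refl])
  define M where "M = density \<mu> (\<lambda>x. ennreal (g x))"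
  have moments: "integrable M (\<lambda>x. x ^ k)" "integral\<^sup>L M (\<lambda>x. x ^ k) = a k / a 0" for k
    unfolding M_def using int[of k] a[of k]
    by (simp_all add: integrable_density[OF power g(1)] integral_density[OF power g(1)] g(2)
        g_power del: real_scaleR_def)
  have "prob_space M"
    unfolding M_def using int[of 0] a[of 0] assms(2) g(2)
    by (intro prob_space_density_real) (simp_all add: g_def)
  then have "real_distribution M"
    by (simp add: real_distribution_def real_distribution_axioms_def M_def sets)
  moreover have "AE x in M. 0 \<le> x"
    unfolding M_def using g(1) by (subst AE_density) (auto simp: g_def indicator_def)
  ultimately have "halfline_distribution M (\<lambda>k. a k / a 0)"
    using moments by (simp add: halfline_distribution_def)
  then show thesis by (rule that)
qed

lemma tight_halfline_distributions:
  assumes \<mu>: "\<And>n. halfline_distribution (\<mu> n) (m n)" and B: "\<And>n. m n 1 \<le> B"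
  shows "tight \<mu>"
  unfolding tight_def
proof (intro conjI allI impI)
  show dist: "real_distribution (\<mu> n)" for n using \<mu> by (simp add: halfline_distribution_def)
  fix \<epsilon> :: real assume "0 < \<epsilon>"
  define b where "b = (\<bar>B\<bar> + 1) / \<epsilon>"
  have b: "0 < b" "\<bar>B\<bar> / b < \<epsilon>" using \<open>0 < \<epsilon>\<close> by (auto simp: b_def field_simps add_pos_nonneg)
  have "1 - \<epsilon> < measure (\<mu> n) {-1<..b}" for n
  proof -
    interpret real_distribution "\<mu> n" by (rule dist)
    have nonneg: "AE x in \<mu> n. 0 \<le> x"
      and "integrable (\<mu> n) (\<lambda>x. x)" "integral\<^sup>L (\<mu> n) (\<lambda>x. x) = m n 1"
      using \<mu>[of n] unfolding halfline_distribution_def by (auto dest: spec[of _ 1])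
    then have "measure (\<mu> n) {x \<in> space (\<mu> n). b \<le> x} \<le> m n 1 / b"
      using integral_Markov_inequality_measure[of "\<mu> n" "\<lambda>x. x" "{}" b] b(1) by simp
    also have "\<dots> \<le> \<bar>B\<bar> / b" using B[of n] b(1) by (intro divide_right_mono) auto
    also have "\<dots> < \<epsilon>" by (rule b)
    finally have "measure (\<mu> n) {x \<in> space (\<mu> n). b \<le> x} < \<epsilon>" .
    moreover have "1 - measure (\<mu> n) {-1<..b} = measure (\<mu> n) (space (\<mu> n) - {-1<..b})"
      by (rule prob_compl[symmetric]) simp
    moreover have "\<dots> \<le> measure (\<mu> n) {x \<in> space (\<mu> n). b \<le> x}"
      by (rule finite_measure_mono_AE) (use nonneg in auto)
    ultimately show ?thesis by linarith
  qed
  then show "\<exists>a b. a < b \<and> (\<forall>n. 1 - \<epsilon> < measure (\<mu> n) {a<..b})"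
    using b by (intro exI[of _ "-1"] exI[of _ b]) auto
qed

lemma (in real_distribution) integrable_bounded_continuous:
  fixes f :: "real \<Rightarrow> real"
  assumes "continuous_on UNIV f" "\<And>x. \<bar>f x\<bar> \<le> C"
  shows "integrable M f"
proof (rule integrable_const_bound[where B = C])
  show "f \<in> borel_measurable M"
    using borel_measurable_continuous_onI[OF assms(1)]
    by (simp add: measurable_cong_sets[OF events_eq_borel refl])
qed (use assms(2) in auto)

lemma weak_conv_integral_bounded_continuous:
  fixes f :: "real \<Rightarrow> real"
  assumes "\<And>n. real_distribution (\<nu> n)" "real_distribution M" "weak_conv_m \<nu> M"
    and "continuous_on UNIV f" "\<And>x. \<bar>f x\<bar> \<le> C"
  shows "(\<lambda>n. integral\<^sup>L (\<nu> n) f) \<longlonglongrightarrow> integral\<^sup>L M f"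
  using assms
  by (intro weak_conv_imp_integral_bdd_continuous_conv[where B = C])
    (auto simp: continuous_on_eq_continuous_at)

lemma weak_limit_halfline_nonneg:
  assumes \<nu>: "\<And>n. real_distribution (\<nu> n)" "\<And>n. AE x in \<nu> n. 0 \<le> x"
    and M: "real_distribution M" and conv: "weak_conv_m \<nu> M"
  shows "AE x in M. 0 \<le> x"
proof -
  interpret M: real_distribution M by (rule M)
  define neg where "neg x = min 1 (max 0 (- x))" for x :: real
  have neg: "continuous_on UNIV neg" "\<And>x. \<bar>neg x\<bar> \<le> 1"
    unfolding neg_def by (intro continuous_intros) auto
  have "integral\<^sup>L (\<nu> n) neg = 0" for n
  proof -
    have "AE x in \<nu> n. neg x = 0" using \<nu>(2)[of n] by eventually_elim (simp add: neg_def)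
    then show ?thesis by (rule integral_eq_zero_AE)
  qed
  then have "(\<lambda>n. 0) \<longlonglongrightarrow> integral\<^sup>L M neg"
    using weak_conv_integral_bounded_continuous[OF \<nu>(1) M conv neg] by simp
  then have "integral\<^sup>L M neg = 0" by (simp add: LIMSEQ_const_iff)
  then have "AE x in M. neg x = 0"
    using integral_nonneg_eq_0_iff_AE[OF M.integrable_bounded_continuous[OF neg]]
    by (simp add: neg_def)
  then show ?thesis by eventually_elim (auto simp: neg_def min_def max_def split: if_splits)
qed

definition truncated_power :: "real \<Rightarrow> nat \<Rightarrow> real \<Rightarrow> real" where
  "truncated_power R k x = (min R (max 0 x)) ^ k"

lemma continuous_on_truncated_power: "continuous_on UNIV (truncated_power R k)"
  unfolding truncated_power_def by (intro continuous_intros)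

lemma truncated_power_bound: "0 \<le> R \<Longrightarrow> \<bar>truncated_power R k x\<bar> \<le> R ^ k"
  unfolding truncated_power_def power_abs by (intro power_mono) auto

lemma truncated_power_le: "0 \<le> R \<Longrightarrow> 0 \<le> x \<Longrightarrow> truncated_power R k x \<le> x ^ k"
  unfolding truncated_power_def by (intro power_mono) auto

lemma truncated_power_ge:
  assumes "0 < R" "0 \<le> x"
  shows "x ^ k - x ^ Suc k / R \<le> truncated_power R k x"
proof (cases "x \<le> R")
  case True
  then show ?thesis using assms by (simp add: truncated_power_def)
next
  case False
  then have "x ^ k * 1 \<le> x ^ k * (x / R)"
    using assms by (intro mult_left_mono) auto
  then have "x ^ k - x ^ Suc k / R \<le> 0" by (simp add: mult.commute)
  also have "0 \<le> truncated_power R k x" using assms by (simp add: truncated_power_def)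
  finally show ?thesis .
qed

lemma truncated_moment_bounds:
  assumes "halfline_distribution M a" "0 < R"
  shows "a k - a (Suc k) / R \<le> integral\<^sup>L M (truncated_power R k)"
    and "integral\<^sup>L M (truncated_power R k) \<le> a k"
proof -
  interpret real_distribution M using assms(1) by (simp add: halfline_distribution_def)
  have nonneg: "AE x in M. 0 \<le> x" and int: "integrable M (\<lambda>x. x ^ j)"
    and a: "integral\<^sup>L M (\<lambda>x. x ^ j) = a j" for j
    using assms(1) by (auto simp: halfline_distribution_def)
  have trunc: "integrable M (truncated_power R k)"
    using continuous_on_truncated_power truncated_power_bound assms(2)
    by (intro integrable_bounded_continuous[where C = "R ^ k"]) auto
  have "(LINT x|M. x ^ k - x ^ Suc k / R) \<le> integral\<^sup>L M (truncated_power R k)"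
    using int nonneg assms(2)
    by (intro integral_mono_AE trunc)
      (auto simp del: power_Suc elim!: eventually_mono intro: truncated_power_ge)
  then show "a k - a (Suc k) / R \<le> integral\<^sup>L M (truncated_power R k)"
    using int by (simp add: a del: power_Suc)
  have "integral\<^sup>L M (truncated_power R k) \<le> (LINT x|M. x ^ k)"
    using int nonneg assms(2)
    by (intro integral_mono_AE trunc) (auto elim!: eventually_mono intro: truncated_power_le)
  then show "integral\<^sup>L M (truncated_power R k) \<le> a k" by (simp add: a)
qed

lemma (in real_distribution) moment_of_truncated_moments:
  assumes nonneg: "AE x in M. 0 \<le> x"
    and lim: "(\<lambda>R. integral\<^sup>L M (truncated_power (real (Suc R)) k)) \<longlonglongrightarrow> c"
  shows "integrable M (\<lambda>x. x ^ k)" "integral\<^sup>L M (\<lambda>x. x ^ k) = c"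
proof -
  let ?g = "\<lambda>R. truncated_power (real (Suc R)) k"
  have int: "integrable M (?g R)" for R
    using continuous_on_truncated_power truncated_power_bound
    by (intro integrable_bounded_continuous[where C = "real (Suc R) ^ k"]) auto
  have mono: "AE x in M. mono (\<lambda>R. ?g R x)"
    unfolding truncated_power_def mono_def by (auto intro!: power_mono)
  have pointwise: "AE x in M. (\<lambda>R. ?g R x) \<longlonglongrightarrow> x ^ k"
    using nonneg
  proof eventually_elim
    case (elim x)
    obtain N where N: "x \<le> real N" using real_arch_simple by blast
    have "eventually (\<lambda>R. ?g R x = x ^ k) sequentially"
      using eventually_ge_at_top[of N]
      by eventually_elim (use N elim in \<open>simp add: truncated_power_def min_def max_def\<close>)
    then show ?case by (rule tendsto_eventually)
  qed
  have meas: "(\<lambda>x. x ^ k) \<in> borel_measurable M" by measurable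
  show "integrable M (\<lambda>x. x ^ k)" "integral\<^sup>L M (\<lambda>x. x ^ k) = c"
    by (rule integrable_monotone_convergence[OF int mono pointwise lim meas]
        integral_monotone_convergence[OF int mono pointwise lim meas])+
qed

lemma weak_limit_halfline_distribution:
  assumes \<nu>: "\<And>n. halfline_distribution (\<nu> n) (m n)" and lim: "\<And>k. (\<lambda>n. m n k) \<longlonglongrightarrow> a k"
    and M: "real_distribution M" and conv: "weak_conv_m \<nu> M"
  shows "halfline_distribution M a"
proof -
  have \<nu>_dist: "real_distribution (\<nu> n)" and "AE x in \<nu> n. 0 \<le> x" for n
    using \<nu>[of n] by (auto simp only: halfline_distribution_def)
  then have nonneg: "AE x in M. 0 \<le> x" using M conv by (rule weak_limit_halfline_nonneg)
  have trunc: "(\<lambda>n. integral\<^sup>L (\<nu> n) (truncated_power R k)) \<longlonglongrightarrow> integral\<^sup>L M (truncated_power R k)"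
    if "0 < R" for R k
    using that by (intro weak_conv_integral_bounded_continuous[OF \<nu>_dist M conv, where C = "R ^ k"]
        continuous_on_truncated_power truncated_power_bound) simp
  have "(\<lambda>R. integral\<^sup>L M (truncated_power (real (Suc R)) k)) \<longlonglongrightarrow> a k" for k
  proof (rule tendsto_sandwich[OF always_eventually always_eventually])
    show "\<forall>R. a k - a (Suc k) / real (Suc R) \<le> integral\<^sup>L M (truncated_power (real (Suc R)) k)"
    proof
      fix R
      have "(\<lambda>n. m n k - m n (Suc k) / real (Suc R)) \<longlonglongrightarrow> a k - a (Suc k) / real (Suc R)"
        by (intro tendsto_intros lim) simp
      from LIMSEQ_le[OF this trunc]
      show "a k - a (Suc k) / real (Suc R) \<le> integral\<^sup>L M (truncated_power (real (Suc R)) k)"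
        using truncated_moment_bounds(1)[OF \<nu>] by simp
    qed
    show "\<forall>R. integral\<^sup>L M (truncated_power (real (Suc R)) k) \<le> a k"
      using LIMSEQ_le[OF trunc lim] truncated_moment_bounds(2)[OF \<nu>] by simp
    have "(\<lambda>R. a k - a (Suc k) / real (Suc R)) \<longlonglongrightarrow> a k - 0"
      by (intro tendsto_intros LIMSEQ_Suc[OF lim_const_over_n])
    then show "(\<lambda>R. a k - a (Suc k) / real (Suc R)) \<longlonglongrightarrow> a k" by simp
  qed simp
  from real_distribution.moment_of_truncated_moments[OF M nonneg this]
  show ?thesis using M nonneg by (simp add: halfline_distribution_def)
qed

theorem halfline_distribution_limit:
  assumes \<mu>: "\<And>n. halfline_distribution (\<mu> n) (m n)" and lim: "\<And>k. (\<lambda>n. m n k) \<longlonglongrightarrow> a k"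
  obtains M where "halfline_distribution M a"
proof -
  obtain B where B: "\<forall>n. \<bar>m n 1\<bar> \<le> B"
    using convergent_imp_Bseq[OF convergentI[OF lim[of 1]]]
    by (auto elim!: BseqE simp del: One_nat_def)
  have "tight \<mu>"
    by (rule tight_halfline_distributions[OF \<mu>]) (use B in \<open>blast intro: abs_le_D1\<close>)
  from tight_imp_convergent_subsubsequence[OF this strict_mono_id]
  obtain r M where r: "strict_mono (r :: nat \<Rightarrow> nat)" and M: "real_distribution M"
    and conv: "weak_conv_m (\<mu> \<circ> r) M" by auto
  have "halfline_distribution ((\<mu> \<circ> r) n) (m (r n))" for n using \<mu> by simp
  moreover have "(\<lambda>n. m (r n) k) \<longlonglongrightarrow> a k" for k
    using LIMSEQ_subseq_LIMSEQ[OF lim[of k] r] by (simp add: comp_def)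
  ultimately have "halfline_distribution M a"
    using M conv by (rule weak_limit_halfline_distribution)
  then show thesis by (rule that)
qed

section \<open>Stieltjes moment sequences\<close>

lemma stieltjes_moment_atomic:
  assumes "m \<in> atomic_moments"
  shows "stieltjes_moment m"
proof -
  obtain S w where S: "finite S" "\<And>x. x \<in> S \<Longrightarrow> 0 \<le> x" "\<And>x. x \<in> S \<Longrightarrow> 0 \<le> w x"
    and m: "m = (\<lambda>i. \<Sum>x\<in>S. w x * x ^ i)"
    using assms by (auto simp: atomic_moments_def)
  define \<mu> where "\<mu> = distr (point_measure S (\<lambda>x. ennreal (w x))) borel (\<lambda>x. x)"
  have "set_integrable \<mu> {0..} (\<lambda>x. x ^ n)" for n
    unfolding set_integrable_def \<mu>_def
    by (subst integrable_distr_eq) (simp_all add: integrable_point_measure_finite S)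
  moreover have "(LINT x:{0..}|\<mu>. x ^ n) = m n" for n
    unfolding set_lebesgue_integral_def \<mu>_def m
    by (subst integral_distr)
      (auto simp: lebesgue_integral_point_measure_finite S intro!: sum.cong)
  ultimately show ?thesis
    unfolding stieltjes_moment_def by (intro exI[of _ \<mu>]) (simp add: \<mu>_def)
qed

lemma stieltjes_moment_functional_nonneg:
  assumes "stieltjes_moment a" and nonneg: "\<And>x. 0 \<le> x \<Longrightarrow> 0 \<le> poly p x"
  shows "0 \<le> moment_functional a p"
proof -
  obtain \<mu> where int: "\<And>n. integrable \<mu> (\<lambda>x :: real. indicator {0..} x *\<^sub>R x ^ n)"
    and a: "\<And>n. a n = (LINT x|\<mu>. indicator {0..} x *\<^sub>R x ^ n)"
    using assms(1)
    by (auto simp: stieltjes_moment_def set_integrable_def set_lebesgue_integral_def)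
  have "moment_functional a p =
      (LINT x|\<mu>. (\<Sum>i\<le>degree p. coeff p i * (indicator {0..} x *\<^sub>R x ^ i)))"
    using int by (simp add: moment_functional_def a)
  also have "\<dots> \<ge> 0"
  proof (rule integral_nonneg_AE, rule AE_I2)
    fix x
    show "0 \<le> (\<Sum>i\<le>degree p. coeff p i * (indicator {0..} x *\<^sub>R x ^ i))"
      using nonneg[of x] by (cases "0 \<le> x") (auto simp: poly_altdef)
  qed
  finally show ?thesis .
qed

lemma stieltjes_moment_imp_hankel_psd:
  assumes "stieltjes_moment a"
  shows "hankel_psd a" "hankel_psd (\<lambda>n. a (Suc n))"
proof -
  have "0 \<le> quadratic_form (\<lambda>i j. a (i + j + e)) n x" for e n x
  proof -
    let ?r = "\<Sum>i<n. Polynomial.monom (x i) i"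
    have "0 \<le> moment_functional a (Polynomial.monom 1 e * (?r * ?r))"
      using assms by (rule stieltjes_moment_functional_nonneg) (simp add: poly_monom)
    then show ?thesis unfolding moment_functional_monom_sum_square .
  qed
  from this[of 0] this[of 1] show "hankel_psd a" "hankel_psd (\<lambda>n. a (Suc n))"
    by (simp_all add: hankel_psd_def)
qed

lemma hankel_psd_limit:
  assumes "\<And>n. hankel_psd (m n)" and lim: "\<And>k. (\<lambda>n. m n k) \<longlonglongrightarrow> a k"
  shows "hankel_psd a"
  unfolding hankel_psd_def
proof (intro allI)
  fix N x
  have "(\<lambda>n. quadratic_form (\<lambda>i j. m n (i + j)) N x) \<longlonglongrightarrow> quadratic_form (\<lambda>i j. a (i + j)) N x"
    unfolding quadratic_form_def by (intro tendsto_intros lim)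
  then show "0 \<le> quadratic_form (\<lambda>i j. a (i + j)) N x"
    by (rule LIMSEQ_le_const) (use assms(1) in \<open>auto simp: hankel_psd_def\<close>)
qed

theorem stieltjes_moment_limit:
  assumes m: "\<And>n. stieltjes_moment (m n)" and lim: "\<And>k. (\<lambda>n. m n k) \<longlonglongrightarrow> a k"
  shows "stieltjes_moment a"
proof -
  have psd: "hankel_psd a"
    using stieltjes_moment_imp_hankel_psd(1)[OF m] lim by (rule hankel_psd_limit)
  then have "0 \<le> quadratic_form (\<lambda>i j. a (i + j)) (Suc 0) (\<lambda>_. 1)"
    unfolding hankel_psd_def by blast
  then have "0 \<le> a 0" by (simp add: quadratic_form_def)
  then consider "a 0 = 0" | "0 < a 0" by linarith
  then show ?thesis
  proof cases
    case 1
    then have "a = (\<lambda>_. 0)" using hankel_psd_eq_0[OF psd] by auto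
    then show ?thesis using stieltjes_moment_atomic[OF atomic_moments_zero] by simp
  next
    case 2
    have "eventually (\<lambda>n. 0 < m n 0) sequentially"
      using order_tendstoD(1)[OF lim[of 0] 2] .
    then obtain N where "\<forall>n\<ge>N. 0 < m n 0"
      by (auto simp: eventually_sequentially)
    then have "0 < m (n + N) 0" for n by simp
    then have "\<exists>M. halfline_distribution M (\<lambda>k. m (n + N) k / m (n + N) 0)" for n
      using stieltjes_moment_imp_halfline_distribution[OF m] by metis
    then obtain \<mu> where "\<And>n. halfline_distribution (\<mu> n) (\<lambda>k. m (n + N) k / m (n + N) 0)"
      by metis
    moreover have "(\<lambda>n. m (n + N) k / m (n + N) 0) \<longlonglongrightarrow> a k / a 0" for k
      using 2 by (intro tendsto_divide LIMSEQ_ignore_initial_segment lim) simp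
    ultimately obtain M where "halfline_distribution M (\<lambda>k. a k / a 0)"
      by (rule halfline_distribution_limit)
    then have "stieltjes_moment (\<lambda>k. a 0 * (a k / a 0))"
      using 2 by (intro stieltjes_moment_halfline_distribution) auto
    then show ?thesis using 2 by simp
  qed
qed

theorem stieltjes_moment_iff_hankel_psd:
  "stieltjes_moment a \<longleftrightarrow> hankel_psd a \<and> hankel_psd (\<lambda>n. a (Suc n))"
proof
  assume psd: "hankel_psd a \<and> hankel_psd (\<lambda>n. a (Suc n))"
  have "0 \<le> moment_functional a p" if "\<And>x. 0 \<le> x \<Longrightarrow> 0 \<le> poly p x" for p
    using psd that moment_functional_nonneg by blast
  then have "\<exists>m\<in>atomic_moments. \<forall>i\<le>n. \<bar>a i - m i\<bar> < 1 / real (Suc n)" for n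
    by (rule atomic_moments_approx) simp_all
  then have "\<forall>n. \<exists>m. m \<in> atomic_moments \<and> (\<forall>i\<le>n. \<bar>a i - m i\<bar> < 1 / real (Suc n))"
    by blast
  from choice[OF this] obtain m where
    m: "\<And>n. m n \<in> atomic_moments" and approx: "\<And>n i. i \<le> n \<Longrightarrow> \<bar>a i - m n i\<bar> < 1 / real (Suc n)"
    by blast
  have "(\<lambda>n. m n k) \<longlonglongrightarrow> a k" for k
  proof (rule LIM_zero_cancel, rule Lim_null_comparison)
    show "\<forall>\<^sub>F n in sequentially. norm (m n k - a k) \<le> 1 / real (Suc n)"
      using eventually_ge_at_top[of k]
    proof eventually_elim
      case (elim n)
      then show ?case using approx[of k n] by (simp add: abs_minus_commute)
    qed
    show "(\<lambda>n. 1 / real (Suc n)) \<longlonglongrightarrow> 0" by (rule LIMSEQ_Suc[OF lim_const_over_n])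
  qed
  then show "stieltjes_moment a"
    by (rule stieltjes_moment_limit[OF stieltjes_moment_atomic[OF m]])
qed (use stieltjes_moment_imp_hankel_psd in auto)

section \<open>Convolutions that preserve the Stieltjes moment property\<close>

lemma stieltjes_moment_if_hankel_minors_nonneg:
  fixes a :: "nat \<Rightarrow> real"
  assumes "\<And>k r c. strict_mono_on {..<k} r \<Longrightarrow> strict_mono_on {..<k} c \<Longrightarrow>
    0 \<le> imat_minor (\<lambda>i j. a (i + j)) k r c"
  shows "stieltjes_moment a"
proof -
  have "0 \<le> quadratic_form (\<lambda>i j. a (i + j + e)) n x" for e n x
  proof (rule quadratic_form_nonneg)
    show "principal_minors_nonneg (\<lambda>i j. a (i + j + e))"
      unfolding principal_minors_nonneg_def
    proof (intro allI impI)
      fix k and r :: "nat \<Rightarrow> nat" assume r: "strict_mono_on {..<k} r"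
      then have "strict_mono_on {..<k} (\<lambda>i. r i + e)" by (simp add: strict_mono_on_def)
      then have "0 \<le> imat_minor (\<lambda>i j. a (i + j)) k (\<lambda>i. r i + e) r" using r by (rule assms)
      then show "0 \<le> imat_minor (\<lambda>i j. a (i + j + e)) k r r"
        by (simp add: imat_minor_def add_ac)
    qed
  qed (simp add: add.commute)
  from this[of 0] this[of 1] show ?thesis
    by (simp add: stieltjes_moment_iff_hankel_psd hankel_psd_def)
qed

lemma hankel_psd_scale:
  assumes "hankel_psd a" "0 \<le> c"
  shows "hankel_psd (\<lambda>n. c * y ^ n * a n)"
  unfolding hankel_psd_def
proof (intro allI)
  fix n x
  have "quadratic_form (\<lambda>i j. c * y ^ (i + j) * a (i + j)) n x =
      c * quadratic_form (\<lambda>i j. a (i + j)) n (\<lambda>i. y ^ i * x i)"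
    by (simp add: quadratic_form_def sum_distrib_left power_add mult_ac)
  also have "\<dots> \<ge> 0" using assms by (simp add: hankel_psd_def)
  finally show "0 \<le> quadratic_form (\<lambda>i j. c * y ^ (i + j) * a (i + j)) n x" .
qed

lemma stieltjes_moment_scale:
  assumes "stieltjes_moment a" "0 \<le> y"
  shows "stieltjes_moment (\<lambda>n. y ^ n * a n)"
  using assms hankel_psd_scale[of a 1 y] hankel_psd_scale[of "\<lambda>n. a (Suc n)" y y]
  by (simp add: stieltjes_moment_iff_hankel_psd mult.assoc)

lemma hankel_psd_mixture:
  assumes s: "stieltjes_moment s" and P: "\<And>x. 0 \<le> x \<Longrightarrow> hankel_psd (\<lambda>n. poly (P n) x)"
  shows "hankel_psd (\<lambda>n. moment_functional s (P n))"
  unfolding hankel_psd_def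
proof (intro allI)
  fix n x
  let ?p = "\<Sum>i<n. \<Sum>j<n. Polynomial.smult (x i * x j) (P (i + j))"
  have "quadratic_form (\<lambda>i j. moment_functional s (P (i + j))) n x = moment_functional s ?p"
    by (simp add: quadratic_form_def moment_functional_sum moment_functional_smult)
  also have "\<dots> \<ge> 0"
  proof (rule stieltjes_moment_functional_nonneg[OF s])
    fix t :: real assume "0 \<le> t"
    then have "0 \<le> quadratic_form (\<lambda>i j. poly (P (i + j)) t) n x"
      using P by (simp add: hankel_psd_def)
    then show "0 \<le> poly ?p t" by (simp add: quadratic_form_def poly_sum)
  qed
  finally show "0 \<le> quadratic_form (\<lambda>i j. moment_functional s (P (i + j))) n x" .
qed

theorem stieltjes_moment_mixture:
  assumes "stieltjes_moment s" and "\<And>x. 0 \<le> x \<Longrightarrow> stieltjes_moment (\<lambda>n. poly (P n) x)"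
  shows "stieltjes_moment (\<lambda>n. moment_functional s (P n))"
  using assms hankel_psd_mixture[of s P] hankel_psd_mixture[of s "\<lambda>n. P (Suc n)"]
  by (simp add: stieltjes_moment_iff_hankel_psd)

lemma stieltjes_moment_homogenized:
  fixes J :: "nat \<Rightarrow> nat \<Rightarrow> real"
  assumes J: "\<And>q. 0 \<le> q \<Longrightarrow> stieltjes_moment (\<lambda>n. \<Sum>k\<le>n. J n k * q ^ k)"
    and "0 \<le> x" "0 \<le> y"
  shows "stieltjes_moment (\<lambda>n. \<Sum>k\<le>n. J n k * x ^ k * y ^ (n - k))"
proof -
  have pos: "stieltjes_moment (\<lambda>n. \<Sum>k\<le>n. J n k * x ^ k * y ^ (n - k))" if "0 < y" for y
  proof -
    have "y ^ n * (\<Sum>k\<le>n. J n k * (x / y) ^ k) = (\<Sum>k\<le>n. J n k * x ^ k * y ^ (n - k))" for n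
      unfolding sum_distrib_left using that
      by (intro sum.cong refl) (simp add: power_diff power_divide field_simps)
    moreover have "stieltjes_moment (\<lambda>n. y ^ n * (\<Sum>k\<le>n. J n k * (x / y) ^ k))"
      using that \<open>0 \<le> x\<close> by (intro stieltjes_moment_scale J) simp_all
    ultimately show ?thesis by simp
  qed
  have "(\<lambda>i. y + inverse (real (Suc i))) \<longlonglongrightarrow> y + 0"
    by (intro tendsto_intros LIMSEQ_inverse_real_of_nat)
  then have "(\<lambda>i. \<Sum>k\<le>n. J n k * x ^ k * (y + inverse (real (Suc i))) ^ (n - k))
      \<longlonglongrightarrow> (\<Sum>k\<le>n. J n k * x ^ k * y ^ (n - k))" for n
    by (intro tendsto_intros) simp
  moreover have "0 < y + inverse (real (Suc i))" for i
    using \<open>0 \<le> y\<close> by (intro add_nonneg_pos) simp_all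
  ultimately show ?thesis by (intro stieltjes_moment_limit[OF pos])
qed

theorem stieltjes_moment_convolution:
  fixes J :: "nat \<Rightarrow> nat \<Rightarrow> real"
  assumes J: "\<And>q. 0 \<le> q \<Longrightarrow> stieltjes_moment (\<lambda>n. \<Sum>k\<le>n. J n k * q ^ k)"
    and s: "stieltjes_moment s" and t: "stieltjes_moment t"
  shows "stieltjes_moment (\<lambda>n. \<Sum>k\<le>n. J n k * s k * t (n - k))"
proof -
  have inner: "stieltjes_moment (\<lambda>n. \<Sum>k\<le>n. J n k * s k * y ^ (n - k))" if "0 \<le> y" for y
  proof -
    let ?P = "\<lambda>n. \<Sum>k\<le>n. Polynomial.monom (J n k * y ^ (n - k)) k"
    have "stieltjes_moment (\<lambda>n. moment_functional s (?P n))"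
      using stieltjes_moment_homogenized[OF J _ that]
      by (intro stieltjes_moment_mixture[OF s]) (simp add: poly_sum poly_monom mult_ac)
    then show ?thesis by (simp add: moment_functional_sum moment_functional_monom mult_ac)
  qed
  let ?P = "\<lambda>n. \<Sum>k\<le>n. Polynomial.monom (J n k * s k) (n - k)"
  have "stieltjes_moment (\<lambda>n. moment_functional t (?P n))"
    using inner by (intro stieltjes_moment_mixture[OF t]) (simp add: poly_sum poly_monom)
  then show ?thesis by (simp add: moment_functional_sum moment_functional_monom)
qed

section \<open>Evaluation at nonnegative reals\<close>

definition monomial_value :: "('v \<Rightarrow> real) \<Rightarrow> ('v \<Rightarrow>\<^sub>0 nat) \<Rightarrow> real" where
  "monomial_value \<rho> e = (\<Prod>v \<in> Poly_Mapping.keys e. \<rho> v ^ Poly_Mapping.lookup e v)"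

lemma meval_eq_sum_monomial_value:
  "meval \<rho> p = (\<Sum>e \<in> Poly_Mapping.keys p. Poly_Mapping.lookup p e * monomial_value \<rho> e)"
  by (simp add: meval_def monomial_value_def)

lemma monomial_value_add: "monomial_value \<rho> (e + e') = monomial_value \<rho> e * monomial_value \<rho> e'"
proof -
  let ?K = "Poly_Mapping.keys e \<union> Poly_Mapping.keys e'"
  have eq: "monomial_value \<rho> f = (\<Prod>v\<in>?K. \<rho> v ^ Poly_Mapping.lookup f v)"
    if "Poly_Mapping.keys f \<subseteq> ?K" for f
    unfolding monomial_value_def using that
    by (intro prod.mono_neutral_left) (auto simp: in_keys_iff)
  show ?thesis
    using eq[OF keys_add] eq[of e] eq[of e'] by (simp add: lookup_add power_add prod.distrib)
qed

lemma meval_add: "meval \<rho> (p + r) = meval \<rho> p + meval \<rho> r"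
  unfolding meval_eq_sum_monomial_value
  by (rule setsum_keys_plus_distrib) (simp_all add: distrib_right)

lemma meval_zero [simp]: "meval \<rho> 0 = 0"
  by (simp add: meval_def)

lemma meval_sum: "meval \<rho> (sum f I) = (\<Sum>i\<in>I. meval \<rho> (f i))"
  by (induction I rule: infinite_finite_induct) (simp_all add: meval_add)

lemma meval_single: "meval \<rho> (Poly_Mapping.single e c) = c * monomial_value \<rho> e"
  by (simp add: meval_eq_sum_monomial_value)

lemma meval_mult: "meval \<rho> (p * r) = meval \<rho> p * meval \<rho> r"
  unfolding mpoly_mult_eq_sum_single[of p r] meval_sum meval_single monomial_value_add
  by (simp add: meval_eq_sum_monomial_value sum_product mult_ac)

lemma comm_ring_hom_meval: "comm_ring_hom (meval \<rho>)"
proof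
  show "meval \<rho> 1 = 1"
    using meval_single[of \<rho> 0 1] by (simp add: monomial_value_def)
qed (simp_all add: meval_add meval_mult)

lemma meval_nonneg: "(\<And>v. 0 \<le> \<rho> v) \<Longrightarrow> mcoeff_nonneg p \<Longrightarrow> 0 \<le> meval \<rho> p"
  by (auto simp: meval_def mcoeff_nonneg_def intro!: sum_nonneg mult_nonneg_nonneg prod_nonneg)

lemma comm_ring_hom_poly_map_poly:
  assumes "comm_ring_hom h"
  shows "comm_ring_hom (\<lambda>p. poly (map_poly h p) q)"
proof -
  interpret comm_ring_hom h by (rule assms)
  interpret map_poly: map_poly_comm_ring_hom h ..
  show ?thesis by unfold_locales (simp_all add: map_poly.hom_add map_poly.hom_mult)
qed

lemma poly_map_poly_meval_nonneg:
  assumes "\<And>v. 0 \<le> \<rho> v" "0 \<le> q" "\<forall>d. mcoeff_nonneg (coeff p d)"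
  shows "0 \<le> poly (map_poly (meval \<rho>) p) q"
  using assms
  by (auto simp: poly_altdef coeff_map_poly intro!: sum_nonneg mult_nonneg_nonneg meval_nonneg)

lemma poly_map_poly_meval_jacobi_rogers_row:
  "poly (map_poly (meval \<rho>) (jacobi_rogers_row m \<beta> n)) q =
    (\<Sum>k\<le>n. meval \<rho> (jacobi_rogers m \<beta> n k) * q ^ k)"
proof -
  interpret eval: comm_ring_hom "\<lambda>p. poly (map_poly (meval \<rho>) p) q"
    by (intro comm_ring_hom_poly_map_poly comm_ring_hom_meval)
  show ?thesis
    by (simp add: jacobi_rogers_row_def eval.hom_sum map_poly_monom poly_monom)
qed

theorem stieltjes_moment_meval_row:
  assumes "nonneg_mpoly_poly.tot_pos (\<lambda>i j. jacobi_rogers_row m \<beta> (i + j))"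
    and \<rho>: "\<And>v. 0 \<le> \<rho> v" and q: "0 \<le> q"
  shows "stieltjes_moment (\<lambda>n. \<Sum>k\<le>n. meval \<rho> (jacobi_rogers m \<beta> n k) * q ^ k)"
proof (rule stieltjes_moment_if_hankel_minors_nonneg)
  let ?H = "\<lambda>i j. jacobi_rogers_row m \<beta> (i + j)"
  fix k and r c :: "nat \<Rightarrow> nat"
  assume "strict_mono_on {..<k} r" "strict_mono_on {..<k} c"
  then have "\<forall>d. mcoeff_nonneg (coeff (imat_minor ?H k r c) d)"
    using nonneg_mpoly_poly.tot_posD[OF assms(1)] by blast
  then have "0 \<le> poly (map_poly (meval \<rho>) (imat_minor ?H k r c)) q"
    using \<rho> q by (intro poly_map_poly_meval_nonneg)
  also have "\<dots> = imat_minor (\<lambda>i j. poly (map_poly (meval \<rho>) (?H i j)) q) k r c"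
    by (intro comm_ring_hom.imat_minor_hom[symmetric] comm_ring_hom_poly_map_poly
        comm_ring_hom_meval)
  finally show "0 \<le> imat_minor (\<lambda>i j.
      \<Sum>l\<le>i + j. meval \<rho> (jacobi_rogers m \<beta> (i + j) l) * q ^ l) k r c"
    by (simp add: poly_map_poly_meval_jacobi_rogers_row)
qed

lemma parameter_values_mcoeff_nonneg: "parameter_values \<theta> \<Longrightarrow> mcoeff_nonneg (\<theta> p)"
  unfolding parameter_values_def mvar_def mconst_def
  by (metis mcoeff_nonneg_single zero_le_one)

theorem theorem1p14:
  fixes m :: enat
    and \<beta> :: "int \<Rightarrow> nat \<Rightarrow> (param + 'x) mpoly"
    and \<theta> :: "param \<Rightarrow> (param + 'x) mpoly"
    and f :: "nat \<Rightarrow> (param + 'x) mpoly fps"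
    and Ms Ns :: "(param + 'x) mpoly imat list"
  assumes m: "1 \<le> m"
    and params: "parameter_values \<theta>"
    and pf: "\<And>i. 1 \<le> i \<Longrightarrow> polya_frequency xvars (f i)"
    and factors: "\<And>M. M \<in> set Ms \<union> set Ns \<Longrightarrow>
      \<exists>i\<ge>1. M = Lmat (\<theta> (Pahat i)) (\<theta> (Pbhat i)) (\<theta> (Pchat i)) \<or> M = Gmat (f i)"
    and prod: "Pmat m \<beta> =
      imat_prod (Ms @ [Jmat (\<theta> Pa) (\<theta> Pb) (\<theta> Pu) (\<theta> Pv) (\<theta> Plam)] @ Ns)"
  shows "log_convex_order 3 (jacobi_rogers_row m \<beta>) \<and>
    (\<forall>\<rho>. (\<forall>w. 0 \<le> \<rho> w) \<longrightarrow>
      (\<forall>s t. stieltjes_moment s \<longrightarrow> stieltjes_moment t \<longrightarrow>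
        stieltjes_moment (\<lambda>n. \<Sum>k\<le>n. meval \<rho> (jacobi_rogers m \<beta> n k) * s k * t (n - k))))"
proof (intro conjI allI impI)
  note \<theta> = parameter_values_mcoeff_nonneg[OF params]
  have "production_factor M"
    if "M \<in> set (Ms @ [Jmat (\<theta> Pa) (\<theta> Pb) (\<theta> Pu) (\<theta> Pv) (\<theta> Plam)] @ Ns)" for M
    using that factors[of M] pf by (auto intro: production_factor.intros \<theta>)
  then have tot_pos: "nonneg_mpoly_poly.tot_pos (\<lambda>i j. jacobi_rogers_row m \<beta> (i + j))"
    using prod by (rule tot_pos_hankel_jacobi_rogers_row)
  show "log_convex_order 3 (jacobi_rogers_row m \<beta>)"
    unfolding log_convex_order_def using nonneg_mpoly_poly.Lop_funpow_mem[OF tot_pos] by blast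
  fix \<rho> :: "param + 'x \<Rightarrow> real" and s t
  assume "\<forall>w. 0 \<le> \<rho> w" and s: "stieltjes_moment s" and t: "stieltjes_moment t"
  then have "stieltjes_moment (\<lambda>n. \<Sum>k\<le>n. meval \<rho> (jacobi_rogers m \<beta> n k) * q ^ k)" if "0 \<le> q" for q
    using that by (intro stieltjes_moment_meval_row[OF tot_pos]) auto
  then show "stieltjes_moment (\<lambda>n. \<Sum>k\<le>n. meval \<rho> (jacobi_rogers m \<beta> n k) * s k * t (n - k))"
    using s t by (rule stieltjes_moment_convolution)
qed

end
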